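(* Let $f\in\omega^\omega$. If there is no infinite r.e. set $Y\subseteq\omega^{<\omega}$ which is $\Sigma^0_1$-dense in $f$, then $f$ is recursive in a 1-generic set, i.e. there is a 1-generic set $G\in 2^\omega$ with $f\leq_T G$.
   Context: $\omega^{<\omega}$ is the set of finite strings of natural numbers and $2^{<\omega}$ the set of finite binary strings. $\sigma\sqsubseteq\tau$ means that $\sigma$ is an initial segment of $\tau$ (not necessarily proper; $\tau$ may be a finite string or an infinite sequence), in which case $\tau$ is said to extend $\sigma$. $f\upharpoonright n$ is the initial segment of $f$ of length $n$. "r.e." means recursively enumerable, and $\leq_T$ is Turing reducibility. A set $G\in 2^\omega$ is 1-generic if, for every r.e. set $S\subseteq 2^{<\omega}$, either some initial segment of $G$ lies in $S$, or some initial segment $\rho\sqsubseteq G$ has no extension in $S$. Let $f\in\omega^\omega$. A set $W\subseteq\omega^{<\omega}$ is dense in $f$ if $(\forall n)(\exists\sigma\in W)(f\upharpoonright n\sqsubseteq\sigma)$. An infinite r.e. set $Y\subseteq\omega^{<\omega}$ is $\Sigma^0_1$-dense in $f$ if (a) no member of $Y$ is an initial segment of $f$; and (b) for every r.e. set $W\subseteq\omega^{<\omega}$ which is dense in $f$, some member of $W$ extends some member of $Y$. *)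

theory Defs
  imports Main "HOL-Library.Nat_Bijection" "HOL-Library.Sublist"
begin

text \<open>
  Programs for the partial recursive functions relative to an oracle. All functions are unary on
  the natural numbers; several arguments are packed by the Cantor pairing \<^const>\<open>prod_encode\<close>,
  whose pairing and projections are therefore taken as basic operations.
\<close>

datatype prog =
    PZero
  | PSucc
  | PFst
  | PSnd
  | POracle
  | PPair prog prog
  | PComp prog prog
  | PRec prog prog
  | PMu prog

text \<open>
  \<open>evals g p x y\<close>: with oracle \<open>g\<close>, program \<open>p\<close> halts on input \<open>x\<close> with output \<open>y\<close>.
  \<open>PMu\<close> is unbounded search, which requires all earlier values to be defined.
\<close>

inductive evals :: "(nat \<Rightarrow> nat) \<Rightarrow> prog \<Rightarrow> nat \<Rightarrow> nat \<Rightarrow> bool" for g :: "nat \<Rightarrow> nat" where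
  evals_zero: "evals g PZero x 0"
| evals_succ: "evals g PSucc x (Suc x)"
| evals_fst: "evals g PFst (prod_encode (x, y)) x"
| evals_snd: "evals g PSnd (prod_encode (x, y)) y"
| evals_oracle: "evals g POracle x (g x)"
| evals_pair: "evals g p x y \<Longrightarrow> evals g q x z \<Longrightarrow> evals g (PPair p q) x (prod_encode (y, z))"
| evals_comp: "evals g q x y \<Longrightarrow> evals g p y z \<Longrightarrow> evals g (PComp p q) x z"
| evals_rec_0: "evals g p x y \<Longrightarrow> evals g (PRec p q) (prod_encode (x, 0)) y"
| evals_rec_Suc:
    "evals g (PRec p q) (prod_encode (x, n)) y \<Longrightarrow>
     evals g q (prod_encode (x, prod_encode (n, y))) z \<Longrightarrow>
     evals g (PRec p q) (prod_encode (x, Suc n)) z"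
| evals_mu:
    "evals g p (prod_encode (x, n)) 0 \<Longrightarrow>
     (\<forall>m<n. \<exists>k. evals g p (prod_encode (x, m)) (Suc k)) \<Longrightarrow>
     evals g (PMu p) x n"

inductive_cases evals_elims:
  "evals g PZero x y" "evals g PSucc x y" "evals g PFst x y" "evals g PSnd x y"
  "evals g POracle x y" "evals g (PPair p q) x y" "evals g (PComp p q) x y"
  "evals g (PRec p q) x y" "evals g (PMu p) x y"

lemma evals_deterministic: "evals g p x y \<Longrightarrow> evals g p x z \<Longrightarrow> y = z"
proof (induction arbitrary: z rule: evals.induct)
  case (evals_mu p x n)
  from evals_mu.prems have z: "evals g p (prod_encode (x, z)) 0"
      "\<forall>m<z. \<exists>k. evals g p (prod_encode (x, m)) (Suc k)"
    by (blast elim: evals_elims(9))+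
  show ?case
  proof (cases n z rule: linorder_cases)
    case less
    with z(2) evals_mu.IH(1) show ?thesis by blast
  next
    case greater
    with z(1) evals_mu.IH(2) show ?thesis by blast
  qed
next
  case (evals_pair p x y q z w)
  from evals_pair.prems show ?case
    by (rule evals_elims(6)) (use evals_pair.IH in blast)
next
  case (evals_comp q x y p z w)
  from evals_comp.prems show ?case
    by (rule evals_elims(7)) (use evals_comp.IH in blast)
next
  case (evals_rec_0 p x y q w)
  from evals_rec_0.prems show ?case
    by (rule evals_elims(8)) (use evals_rec_0.IH in \<open>auto simp: prod_encode_eq\<close>)
next
  case (evals_rec_Suc p q x n y z w)
  from evals_rec_Suc.prems show ?case
    by (rule evals_elims(8)) (use evals_rec_Suc.IH in \<open>auto simp: prod_encode_eq\<close>)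
qed (auto elim!: evals_elims(1-5) simp: prod_encode_eq)

definition turing_reducible :: "(nat \<Rightarrow> nat) \<Rightarrow> (nat \<Rightarrow> nat) \<Rightarrow> bool"  (infix "\<le>\<^sub>T" 50) where
  "f \<le>\<^sub>T g \<longleftrightarrow> (\<exists>p. \<forall>x. evals g p x (f x))"

text \<open>Unrelativised computation is computation with the zero function as oracle.\<close>

definition re_set :: "nat set \<Rightarrow> bool" where
  "re_set A \<longleftrightarrow> (\<exists>p. A = {x. \<exists>y. evals (\<lambda>_. 0) p x y})"

definition re_strings :: "nat list set \<Rightarrow> bool" where
  "re_strings W \<longleftrightarrow> re_set (list_encode ` W)"

definition re_binary_strings :: "bool list set \<Rightarrow> bool" where
  "re_binary_strings S \<longleftrightarrow> re_strings (map of_bool ` S)"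

definition seg :: "(nat \<Rightarrow> 'a) \<Rightarrow> nat \<Rightarrow> 'a list" where
  "seg f n = map f [0..<n]"

definition initial_segment :: "'a list \<Rightarrow> (nat \<Rightarrow> 'a) \<Rightarrow> bool" where
  "initial_segment \<sigma> f \<longleftrightarrow> (\<exists>n. \<sigma> = seg f n)"

definition one_generic :: "(nat \<Rightarrow> bool) \<Rightarrow> bool" where
  "one_generic G \<longleftrightarrow>
     (\<forall>S. re_binary_strings S \<longrightarrow>
        (\<exists>\<sigma>\<in>S. initial_segment \<sigma> G) \<or>
        (\<exists>\<rho>. initial_segment \<rho> G \<and> \<not> (\<exists>\<tau>\<in>S. prefix \<rho> \<tau>)))"

definition dense_in :: "nat list set \<Rightarrow> (nat \<Rightarrow> nat) \<Rightarrow> bool" where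
  "dense_in W f \<longleftrightarrow> (\<forall>n. \<exists>\<sigma>\<in>W. prefix (seg f n) \<sigma>)"

definition Sigma01_dense_in :: "nat list set \<Rightarrow> (nat \<Rightarrow> nat) \<Rightarrow> bool" where
  "Sigma01_dense_in Y f \<longleftrightarrow>
     infinite Y \<and> re_strings Y \<and>
     (\<forall>\<sigma>\<in>Y. \<not> initial_segment \<sigma> f) \<and>
     (\<forall>W. re_strings W \<and> dense_in W f \<longrightarrow> (\<exists>\<tau>\<in>W. \<exists>\<sigma>\<in>Y. prefix \<sigma> \<tau>))"

end

theory Submission
  imports Defs
begin

text \<open>
A single functional \<open>out\<close> is fixed in advance and \<open>G\<close> is built by finite extension so that
\<open>out\<close> sends its initial segments to initial segments of \<open>f\<close>. A binary string is read as
a list of instructions: lengthen the output; push a pair \<open>(i, e)\<close>, a promise that from now on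
the output stays an initial segment of some member of the \<open>e\<close>-th r.e. set, made in order to
keep the string out of the \<open>i\<close>-th r.e. set \<open>S\<close>; or, once \<open>S\<close> has been met after
all, revoke that promise together with all promises made after it.

To decide \<open>S\<close> above \<open>\<rho>\<close>, first push a vacuous promise for \<open>i\<close>. If some string above
meets \<open>S\<close> and has an output along \<open>f\<close>, revoke: this discards the promises which that string may
have added and which \<open>f\<close> need not keep, and no further obstruction is left. Otherwise no initial
segment of \<open>f\<close> lies in the r.e. set \<open>Y\<close> of outputs of members of \<open>S\<close> above \<open>\<rho>\<close>. If \<open>Y\<close> is
finite, a longer output avoids \<open>S\<close>. If \<open>Y\<close> is infinite, it is not \<open>\<Sigma>\<^sup>0\<^sub>1\<close>-dense in \<open>f\<close>, and
promising an r.e. set dense in \<open>f\<close> none of whose members extends a member of \<open>Y\<close> avoids \<open>S\<close>.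
\<close>

section \<open>Computable functions between coded types\<close>

text \<open>Injectivity suffices for computing, since programs are constrained on codes only. Where
  every number must be a code, \<open>surj code\<close> is assumed separately.\<close>

class coded =
  fixes code :: "'a \<Rightarrow> nat"
  assumes code_eq_iff [simp]: "code x = code y \<longleftrightarrow> x = y"

instantiation nat :: coded
begin
definition [simp]: "code (n :: nat) = n"
instance by standard simp
end

instantiation bool :: coded
begin
definition [simp]: "code b = (of_bool b :: nat)"
instance by standard auto
end

instantiation prod :: (coded, coded) coded
begin
definition code_prod [simp]: "code p = prod_encode (code (fst p), code (snd p))"
instance by standard (auto simp: prod_encode_eq prod_eq_iff)
end

instantiation option :: (coded) coded
begin
definition code_option [simp]: "code p = (case p of None \<Rightarrow> 0 | Some x \<Rightarrow> Suc (code x))"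
instance by standard (auto split: option.splits)
end

lemma list_encode_inject [simp]: "list_encode xs = list_encode ys \<longleftrightarrow> xs = ys"
  by (rule list_encode_eq)

instantiation list :: (coded) coded
begin
definition code_list: "code xs = list_encode (map code xs)"
instance by standard (auto simp: code_list inj_map_eq_map inj_def)
end

lemma code_Nil [simp]: "code [] = 0"
  by (simp add: code_list)

lemma code_Cons [simp]: "code (x # xs) = Suc (prod_encode (code x, code xs))"
  by (simp add: code_list)

text \<open>Makes the code of a list a computable bound on the number of rounds in
  \<open>computable_fold\<close>.\<close>

lemma length_le_code: "length xs \<le> code xs"
proof (induction xs)
  case (Cons x xs)
  then show ?case
    using le_prod_encode_2[of "code xs" "code x"] by simp
qed simp

text \<open>Result type \<open>bool\<close> gives decidable predicates and pairs give several
  arguments, so one family of closure rules covers everything. The oracle stays a parameter: r.e.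
  sets use the zero oracle, the final reduction uses \<open>G\<close>.\<close>

definition computable :: "(nat \<Rightarrow> nat) \<Rightarrow> ('a :: coded \<Rightarrow> 'b :: coded) \<Rightarrow> bool" where
  "computable g h \<longleftrightarrow> (\<exists>p. \<forall>x. evals g p (code x) (code (h x)))"

named_theorems computable_intros

lemma computableI: "(\<And>x. evals g p (code x) (code (h x))) \<Longrightarrow> computable g h"
  by (auto simp: computable_def)

lemma computableE:
  assumes "computable g h"
  obtains p where "\<And>x. evals g p (code x) (code (h x))"
  using assms by (auto simp: computable_def)

lemma evals_fst': "evals g PFst n (fst (prod_decode n))"
  by (metis evals_fst prod.collapse prod_decode_inverse)

lemma evals_snd': "evals g PSnd n (snd (prod_decode n))"
  by (metis evals_snd prod.collapse prod_decode_inverse)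

text \<open>The Cantor pairing is onto, so splitting a number and pairing the halves again returns
  it.\<close>

lemma evals_id: "evals g (PPair PFst PSnd) n n"
  by (metis evals_fst' evals_snd' evals_pair prod.collapse prod_decode_inverse)

text \<open>
  Only the branch \<open>q\<close> for \<open>0\<close> is run unconditionally. This matters in case distinctions, where
  \<open>p\<close> halts only on codes and so must not be run in the other case.
\<close>

definition prog_if :: "prog \<Rightarrow> prog \<Rightarrow> prog \<Rightarrow> prog" where
  "prog_if c p q = PComp (PRec q (PComp p PFst)) (PPair (PPair PFst PSnd) c)"

lemma evals_prog_if_0:
  assumes "evals g c x 0" "evals g q x y"
  shows "evals g (prog_if c p q) x y"
  unfolding prog_if_def
  by (rule evals_comp[OF evals_pair[OF evals_id assms(1)] evals_rec_0[OF assms(2)]])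

lemma evals_prog_if_Suc:
  assumes "evals g c x (Suc n)" "evals g q x z" "evals g p x y"
  shows "evals g (prog_if c p q) x y"
proof -
  have "evals g (PRec q (PComp p PFst)) (prod_encode (x, Suc m)) y" for m
  proof (induction m)
    case 0
    show ?case
      by (rule evals_rec_Suc[OF evals_rec_0[OF assms(2)] evals_comp[OF evals_fst assms(3)]])
  next
    case (Suc m)
    show ?case
      by (rule evals_rec_Suc[OF Suc evals_comp[OF evals_fst assms(3)]])
  qed
  then show ?thesis
    unfolding prog_if_def by (rule evals_comp[OF evals_pair[OF evals_id assms(1)]])
qed

text \<open>The recursion discards its previous value and returns its counter. It serves to strip
  the \<open>Suc\<close> from the code of \<open>Some\<close>.\<close>

definition prog_pred :: prog where
  "prog_pred = PComp (PRec PZero (PComp PFst PSnd)) (PPair PZero (PPair PFst PSnd))"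

lemma evals_prog_pred: "evals g prog_pred n (n - 1)"
proof -
  have "evals g (PRec PZero (PComp PFst PSnd)) (prod_encode (x, n)) (n - 1)" for x
  proof (induction n)
    case 0
    show ?case by (auto intro: evals.intros)
  next
    case (Suc n)
    show ?case
      by (rule evals_rec_Suc[OF Suc]) (auto intro: evals.intros)
  qed
  then show ?thesis
    unfolding prog_pred_def by (intro evals_comp[OF evals_pair[OF evals_zero evals_id]])
qed

section \<open>Closure properties of the computable functions\<close>

lemma computable_const [computable_intros]: "computable g (\<lambda>x. c)"
proof -
  have "\<exists>p. \<forall>x. evals g p x n" for n
    by (induction n) (meson evals_zero evals_succ evals_comp)+
  then show ?thesis unfolding computable_def by blast
qed

lemma computable_id [computable_intros]: "computable g (\<lambda>x. x)"
  by (rule computableI[of _ "PPair PFst PSnd"]) (rule evals_id)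

lemma computable_oracle:
  assumes "\<And>n. g n = code (h n)"
  shows "computable g h"
  by (rule computableI[of _ POracle]) (metis assms code_nat_def evals_oracle)

lemma computable_compI:
  assumes "computable g a" "\<And>y. evals g q (code y) (code (h y))"
  shows "computable g (\<lambda>x. h (a x))"
proof -
  obtain p where "\<And>x. evals g p (code x) (code (a x))"
    using assms(1) by (rule computableE) blast
  then show ?thesis
    by (intro computableI[of _ "PComp q p"] evals_comp[OF _ assms(2)])
qed

lemma computable_comp:
  assumes "computable g a" "computable g h"
  shows "computable g (\<lambda>x. h (a x))"
  using assms(2) by (elim computableE) (rule computable_compI[OF assms(1)])

lemma computable_code [computable_intros]:
  "computable g a \<Longrightarrow> computable g (\<lambda>x. code (a x))"
  by (simp add: computable_def)

lemma computable_Pair [computable_intros]: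
  assumes "computable g a" "computable g b"
  shows "computable g (\<lambda>x. (a x, b x))"
proof -
  obtain p q where "\<And>x. evals g p (code x) (code (a x))" "\<And>x. evals g q (code x) (code (b x))"
    using assms by (elim computableE) blast
  then show ?thesis
    by (intro computableI[of _ "PPair p q"]) (simp add: evals_pair)
qed

lemma computable_fst [computable_intros]:
  "computable g a \<Longrightarrow> computable g (\<lambda>x. fst (a x))"
  by (erule computable_compI[where q = PFst]) (simp add: evals_fst)

lemma computable_snd [computable_intros]:
  "computable g a \<Longrightarrow> computable g (\<lambda>x. snd (a x))"
  by (erule computable_compI[where q = PSnd]) (simp add: evals_snd)

text \<open>Decoding changes no code: \<open>prod_decode n\<close> has code \<open>n\<close>, so the
  program for \<open>a\<close> works unchanged.\<close>

lemma computable_prod_decode [computable_intros]: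
  "computable g a \<Longrightarrow> computable g (\<lambda>x. prod_decode (a x))"
  by (simp add: computable_def)

lemma map_code_nat [simp]: "map (code :: nat \<Rightarrow> nat) = id"
  by (simp add: fun_eq_iff map_idI)

lemma computable_list_decode [computable_intros]:
  "computable g a \<Longrightarrow> computable g (\<lambda>x. list_decode (a x))"
  by (simp add: computable_def code_list)

lemma computable_Suc [computable_intros]:
  "computable g a \<Longrightarrow> computable g (\<lambda>x. Suc (a x))"
  by (erule computable_compI[where q = PSucc]) (simp add: evals_succ)

lemma computable_Some [computable_intros]:
  "computable g a \<Longrightarrow> computable g (\<lambda>x. Some (a x))"
  by (erule computable_compI[where q = PSucc]) (simp add: evals_succ)

lemma computable_Cons [computable_intros]:
  assumes "computable g a" "computable g b"
  shows "computable g (\<lambda>x. a x # b x)"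
  using computable_compI[OF computable_Pair[OF assms], of PSucc "\<lambda>z. fst z # snd z"]
  by (simp add: evals_succ)

lemma computable_if [computable_intros]:
  assumes "computable g c" "computable g a" "computable g b"
  shows "computable g (\<lambda>x. if c x then a x else b x)"
proof -
  obtain pc pa pb where p: "\<And>x. evals g pc (code x) (code (c x))"
      "\<And>x. evals g pa (code x) (code (a x))" "\<And>x. evals g pb (code x) (code (b x))"
    using assms by (elim computableE) blast
  show ?thesis
  proof (rule computableI)
    fix x
    show "evals g (prog_if pc pa pb) (code x) (code (if c x then a x else b x))"
      using p[of x] by (cases "c x") (auto intro: evals_prog_if_0 evals_prog_if_Suc)
  qed
qed

lemma computable_case_option [computable_intros]:
  assumes "computable g c" "computable g a" "computable g (\<lambda>z. s (fst z) (snd z))"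
  shows "computable g (\<lambda>x. case c x of None \<Rightarrow> a x | Some y \<Rightarrow> s x y)"
proof -
  obtain pc pa ps where p: "\<And>x. evals g pc (code x) (code (c x))"
      "\<And>x. evals g pa (code x) (code (a x))" "\<And>z. evals g ps (code z) (code (s (fst z) (snd z)))"
    using assms by (elim computableE) blast
  let ?q = "PComp ps (PPair (PPair PFst PSnd) (PComp prog_pred pc))"
  show ?thesis
  proof (rule computableI)
    fix x
    show "evals g (prog_if pc ?q pa) (code x) (code (case c x of None \<Rightarrow> a x | Some y \<Rightarrow> s x y))"
    proof (cases "c x")
      case None
      then show ?thesis using p(1,2)[of x] by (auto intro: evals_prog_if_0)
    next
      case (Some y)
      have "evals g prog_pred (code (c x)) (code y)"
        using evals_prog_pred[of g "Suc (code y)"] Some by simp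
      then have "evals g ?q (code x) (code (s x y))"
        using p(3)[of "(x, y)"] by (auto intro!: evals_comp evals_pair evals_id p(1))
      then show ?thesis
        using p(1,2)[of x] Some by (auto intro: evals_prog_if_Suc)
    qed
  qed
qed

text \<open>A list has the same code as the option of its head and tail, which reduces this to
  \<open>computable_case_option\<close>.\<close>

lemma computable_case_list [computable_intros]:
  fixes c :: "'a :: coded \<Rightarrow> 'c :: coded list"
  assumes "computable g c" "computable g a"
    "computable g (\<lambda>z. s (fst z) (fst (snd z)) (snd (snd z)))"
  shows "computable g (\<lambda>x. case c x of [] \<Rightarrow> a x | y # ys \<Rightarrow> s x y ys)"
proof -
  have "computable g (\<lambda>x. case (case c x of [] \<Rightarrow> None | y # ys \<Rightarrow> Some (y, ys)) of
      None \<Rightarrow> a x | Some z \<Rightarrow> s x (fst z) (snd z))"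
  proof (intro computable_case_option)
    have "code (case xs of [] \<Rightarrow> None | y # ys \<Rightarrow> Some (y, ys)) = code xs" for xs :: "'c list"
      by (cases xs) auto
    then show "computable g (\<lambda>x. case c x of [] \<Rightarrow> None | y # ys \<Rightarrow> Some (y, ys))"
      using assms(1) by (simp only: computable_def)
  qed (use assms in simp_all)
  moreover have "(case (case c x of [] \<Rightarrow> None | y # ys \<Rightarrow> Some (y, ys)) of
      None \<Rightarrow> a x | Some z \<Rightarrow> s x (fst z) (snd z)) = (case c x of [] \<Rightarrow> a x | y # ys \<Rightarrow> s x y ys)" for x
    by (cases "c x") auto
  ultimately show ?thesis by simp
qed

lemma computable_rec_nat [computable_intros]:
  assumes "computable g a" "computable g (\<lambda>z. s (fst z) (fst (snd z)) (snd (snd z)))" "computable g n"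
  shows "computable g (\<lambda>x. rec_nat (a x) (s x) (n x))"
proof -
  obtain pa ps pn where p: "\<And>x. evals g pa (code x) (code (a x))"
      "\<And>z. evals g ps (code z) (code (s (fst z) (fst (snd z)) (snd (snd z))))"
      "\<And>x. evals g pn (code x) (code (n x))"
    using assms by (elim computableE) blast
  have "evals g (PRec pa ps) (prod_encode (code x, k)) (code (rec_nat (a x) (s x) k :: 'b))" for x k
  proof (induction k)
    case 0
    show ?case using p(1) by (auto intro: evals_rec_0)
  next
    case (Suc k)
    show ?case
      using p(2)[of "(x, k, rec_nat (a x) (s x) k)"] by (auto intro: evals_rec_Suc[OF Suc])
  qed
  then have "evals g (PComp (PRec pa ps) (PPair (PPair PFst PSnd) pn)) (code x)
      (code (rec_nat (a x) (s x) (n x)))" for x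
    by (rule evals_comp[OF evals_pair[OF evals_id p(3), unfolded code_nat_def]])
  then show ?thesis by (rule computableI)
qed

lemma computable_not [computable_intros]:
  assumes "computable g a"
  shows "computable g (\<lambda>x. \<not> a x)"
proof -
  have "computable g (\<lambda>x. if a x then False else True)"
    by (intro computable_intros assms)
  moreover have "(if P then False else True) \<longleftrightarrow> \<not> P" for P by simp
  ultimately show ?thesis by (simp only:)
qed

lemma computable_conj [computable_intros]:
  assumes "computable g a" "computable g b"
  shows "computable g (\<lambda>x. a x \<and> b x)"
proof -
  have "computable g (\<lambda>x. if a x then b x else False)"
    by (intro computable_intros assms)
  moreover have "(if P then Q else False) \<longleftrightarrow> P \<and> Q" for P Q by simp
  ultimately show ?thesis by (simp only:)
qed

lemma computable_eq_0 [computable_intros]: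
  assumes "computable g (a :: _ \<Rightarrow> nat)"
  shows "computable g (\<lambda>x. a x = 0)"
proof -
  have "computable g (\<lambda>x. rec_nat True (\<lambda>_ _. False) (a x))"
    by (intro computable_intros assms)
  moreover have "rec_nat True (\<lambda>_ _. False) n \<longleftrightarrow> n = 0" for n
    by (cases n) auto
  ultimately show ?thesis by simp
qed

lemma computable_diff [computable_intros]:
  assumes "computable g a" "computable g b"
  shows "computable g (\<lambda>x. a x - b x :: nat)"
proof -
  \<comment> \<open>The inner recursion is the predecessor; subtraction iterates it.\<close>
  have "computable g (\<lambda>x. rec_nat (a x) (\<lambda>_ r. rec_nat 0 (\<lambda>m _. m) r) (b x))"
    by (intro computable_intros assms)
  moreover have "rec_nat m (\<lambda>_ r. rec_nat 0 (\<lambda>m _. m) r) n = m - n" for m n :: nat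
  proof (induction n)
    case (Suc n)
    then show ?case by (cases "m - n") auto
  qed auto
  ultimately show ?thesis by simp
qed

lemma computable_less [computable_intros]:
  assumes "computable g a" "computable g b"
  shows "computable g (\<lambda>x. a x < (b x :: nat))"
proof -
  have "computable g (\<lambda>x. \<not> b x - a x = 0)"
    by (intro computable_intros assms)
  then show ?thesis by (simp add: not_le)
qed

lemma computable_eq [computable_intros]:
  assumes "computable g a" "computable g b"
  shows "computable g (\<lambda>x. a x = b x)"
proof -
  have "computable g (\<lambda>x. code (a x) - code (b x) = 0 \<and> code (b x) - code (a x) = 0)"
    by (intro computable_intros assms)
  moreover have "code (a x) - code (b x) = 0 \<and> code (b x) - code (a x) = 0 \<longleftrightarrow> a x = b x" for x
    using code_eq_iff[of "a x" "b x"] by (auto simp del: code_eq_iff)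
  ultimately show ?thesis by simp
qed

text \<open>The state holds the unread part of the list and the accumulator. Iterating
  \<open>code (l x)\<close> times is enough, because rounds after the list is exhausted change
  nothing.\<close>

lemma computable_fold [computable_intros]:
  fixes s :: "'a :: coded \<Rightarrow> 'c :: coded \<Rightarrow> 'd :: coded \<Rightarrow> 'd"
  assumes "computable g (\<lambda>z. s (fst z) (fst (snd z)) (snd (snd z)))" "computable g l" "computable g a"
  shows "computable g (\<lambda>x. fold (s x) (l x) (a x))"
proof -
  let ?r = "\<lambda>x xs a. rec_nat (xs, a) (\<lambda>_ z. case fst z of [] \<Rightarrow> z | y # ys \<Rightarrow> (ys, s x y (snd z)))"
  have step: "computable g (\<lambda>u. s (fst (fst u)) (fst (snd u)) (snd (snd (snd (fst u)))))"
    by (rule computable_comp[OF _ assms(1), of "\<lambda>u. (fst (fst u), fst (snd u), snd (snd (snd (fst u))))",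
          unfolded fst_conv snd_conv])
      (intro computable_intros)
  have "computable g (\<lambda>x. snd (?r x (l x) (a x) (code (l x))))"
    by (intro computable_intros assms step)
  moreover have "snd (?r x xs a n) = fold (s x) xs a" if "length xs \<le> n" for x xs a n
    using that
  proof (induction n arbitrary: xs a)
    case (Suc n)
    \<comment> \<open>The induction peels off the first round, while \<open>rec_nat\<close> exposes
      the last one. As \<open>h\<close> ignores the counter, the order does not matter.\<close>
    have shift: "rec_nat b (\<lambda>_ z. h z) (Suc m) = rec_nat (h b) (\<lambda>_ z. h z) m"
      for b :: "'c list \<times> 'd" and h and m :: nat
      by (induction m) auto
    show ?case
    proof (cases xs)
      case Nil
      then show ?thesis
        using Suc.IH[of "[]" a] by (subst shift) simp
    next
      case (Cons y ys)
      then show ?thesis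
        using Suc by (subst shift) simp
    qed
  qed simp
  ultimately show ?thesis by (simp add: length_le_code)
qed

lemma computable_rev [computable_intros]:
  assumes "computable g l"
  shows "computable g (\<lambda>x. rev (l x))"
proof -
  have "computable g (\<lambda>x. fold (\<lambda>y r. y # r) (l x) [])"
    by (intro computable_intros assms)
  then show ?thesis by (simp add: rev_conv_fold)
qed

lemma computable_append [computable_intros]:
  fixes a :: "'a :: coded \<Rightarrow> 'b :: coded list"
  assumes "computable g a" "computable g b"
  shows "computable g (\<lambda>x. a x @ b x)"
proof -
  have "computable g (\<lambda>x. fold (\<lambda>y r. y # r) (rev (a x)) (b x))"
    by (intro computable_intros assms)
  moreover have "fold (\<lambda>y r. y # r) (rev xs) ys = xs @ ys" for xs ys :: "'b list"
    by (induction xs) auto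
  ultimately show ?thesis by simp
qed

lemma computable_map [computable_intros]:
  assumes "computable g (\<lambda>z. s (fst z) (snd z))" "computable g l"
  shows "computable g (\<lambda>x. map (s x) (l x))"
proof -
  have step: "computable g (\<lambda>u. s (fst u) (fst (snd u)))"
    by (rule computable_comp[OF _ assms(1), of "\<lambda>u. (fst u, fst (snd u))", unfolded fst_conv snd_conv])
      (intro computable_intros)
  have "computable g (\<lambda>x. rev (fold (\<lambda>y r. s x y # r) (l x) []))"
    by (intro computable_intros assms step)
  moreover have "fold (\<lambda>y r. s x y # r) xs r = rev (map (s x) xs) @ r" for x xs r
    by (induction xs arbitrary: r) auto
  ultimately show ?thesis by simp
qed

lemma computable_length [computable_intros]:
  fixes l :: "'a :: coded \<Rightarrow> 'b :: coded list"
  assumes "computable g l"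
  shows "computable g (\<lambda>x. length (l x))"
proof -
  have "computable g (\<lambda>x. fold (\<lambda>_. Suc) (l x) 0)"
    by (intro computable_intros assms)
  moreover have "fold (\<lambda>_. Suc) xs n = length xs + n" for xs :: "'b list" and n
    by (induction xs arbitrary: n) auto
  ultimately show ?thesis by simp
qed

lemma computable_drop [computable_intros]:
  fixes l :: "'a :: coded \<Rightarrow> 'b :: coded list"
  assumes "computable g n" "computable g l"
  shows "computable g (\<lambda>x. drop (n x) (l x))"
proof -
  have "computable g (\<lambda>x. rec_nat (l x) (\<lambda>_ r. case r of [] \<Rightarrow> [] | y # ys \<Rightarrow> ys) (n x))"
    by (intro computable_intros assms)
  moreover have "rec_nat xs (\<lambda>_ r. case r of [] \<Rightarrow> [] | y # ys \<Rightarrow> ys) n = drop n xs"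
    for xs :: "'b list" and n
  proof (induction n)
    case (Suc n)
    then show ?case by (cases "drop n xs") (auto simp: drop_Suc drop_tl)
  qed simp
  ultimately show ?thesis by simp
qed

lemma computable_take [computable_intros]:
  fixes l :: "'a :: coded \<Rightarrow> 'b :: coded list"
  assumes "computable g n" "computable g l"
  shows "computable g (\<lambda>x. take (n x) (l x))"
proof -
  have "computable g (\<lambda>x. rev (drop (length (l x) - n x) (rev (l x))))"
    by (intro computable_intros assms)
  moreover have "rev (drop (length xs - n) (rev xs)) = take n xs" for xs :: "'b list" and n
    by (cases "n \<le> length xs") (simp_all add: drop_rev)
  ultimately show ?thesis by simp
qed

lemma computable_prefix [computable_intros]:
  fixes a :: "'a :: coded \<Rightarrow> 'b :: coded list"
  assumes "computable g a" "computable g b"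
  shows "computable g (\<lambda>x. prefix (a x) (b x))"
proof -
  have "computable g (\<lambda>x. take (length (a x)) (b x) = a x)"
    by (intro computable_intros assms)
  moreover have "take (length xs) ys = xs \<longleftrightarrow> prefix xs ys" for xs ys :: "'b list"
    by (auto simp: prefix_def) (metis append_take_drop_id)
  ultimately show ?thesis by simp
qed

lemma computable_Ball [computable_intros]:
  assumes "computable g l" "computable g (\<lambda>z. P (fst z) (snd z))"
  shows "computable g (\<lambda>x. \<forall>y\<in>set (l x). P x y)"
proof -
  have step: "computable g (\<lambda>u. P (fst u) (fst (snd u)))"
    by (rule computable_comp[OF _ assms(2), of "\<lambda>u. (fst u, fst (snd u))", unfolded fst_conv snd_conv])
      (intro computable_intros)
  have "computable g (\<lambda>x. fold (\<lambda>y r. P x y \<and> r) (l x) True)"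
    by (intro computable_intros assms step)
  moreover have "fold (\<lambda>y r. P x y \<and> r) xs r \<longleftrightarrow> (\<forall>y\<in>set xs. P x y) \<and> r" for x xs r
    by (induction xs arbitrary: r) auto
  ultimately show ?thesis by simp
qed

lemma computable_Bex [computable_intros]:
  assumes "computable g l" "computable g (\<lambda>z. P (fst z) (snd z))"
  shows "computable g (\<lambda>x. \<exists>y\<in>set (l x). P x y)"
proof -
  have "computable g (\<lambda>x. \<not> (\<forall>y\<in>set (l x). \<not> P x y))"
    by (intro computable_intros assms)
  then show ?thesis by simp
qed

lemma computable_member [computable_intros]:
  assumes "computable g a" "computable g l"
  shows "computable g (\<lambda>x. a x \<in> set (l x))"
proof -
  have "computable g (\<lambda>z. a (fst z))"
    by (rule computable_comp[OF _ assms(1)]) (intro computable_intros)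
  then have "computable g (\<lambda>x. \<exists>y\<in>set (l x). a x = y)"
    by (intro computable_intros assms)
  then show ?thesis by simp
qed

lemma computable_upt [computable_intros]:
  fixes n :: "'a :: coded \<Rightarrow> nat"
  assumes "computable g n"
  shows "computable g (\<lambda>x. [0..<n x])"
proof -
  have "computable g (\<lambda>x. rec_nat [] (\<lambda>k r. r @ [k]) (n x))"
    by (intro computable_intros assms)
  moreover have "rec_nat [] (\<lambda>k r. r @ [k]) n = [0..<n]" for n
    by (induction n) auto
  ultimately show ?thesis by simp
qed

lemma computable_all_less [computable_intros]:
  fixes n :: "'a :: coded \<Rightarrow> nat"
  assumes "computable g n" "computable g (\<lambda>z. P (fst z) (snd z))"
  shows "computable g (\<lambda>x. \<forall>m<n x. P x m)"
proof -
  have "computable g (\<lambda>x. \<forall>m\<in>set [0..<n x]. P x m)"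
    by (intro computable_intros assms)
  then show ?thesis by (simp add: atLeast0LessThan lessThan_iff Ball_def)
qed

text \<open>\<open>PMu\<close> looks for a zero, so truth of \<open>P\<close> is coded as 0. The
  same program yields least witnesses and has as its domain, among codes, the inputs with a
  witness.\<close>

lemma computable_predicate_search:
  assumes "computable g (\<lambda>z :: 'a :: coded \<times> nat. P (fst z) (snd z))"
  obtains p where "\<And>x n. P x n \<Longrightarrow> evals g (PMu p) (code x) (LEAST n. P x n)"
    "\<And>x n. evals g (PMu p) (code x) n \<Longrightarrow> P x n"
proof -
  have "computable g (\<lambda>z. if P (fst z) (snd z) then 0 else Suc 0)"
    by (intro computable_intros assms)
  then obtain p where "\<And>z. evals g p (code z) (code (if P (fst z) (snd z) then 0 else Suc 0))"
    by (rule computableE) blast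
  from this[of "(x, n)" for x n]
  have p: "evals g p (prod_encode (code x, n)) (if P x n then 0 else Suc 0)" for x n
    by simp
  show ?thesis
  proof (rule that)
    fix x :: 'a and n
    assume "P x n"
    then have "P x (LEAST n. P x n)" by (rule LeastI)
    moreover have "\<not> P x m" if "m < (LEAST n. P x n)" for m
      using that by (rule not_less_Least)
    ultimately show "evals g (PMu p) (code x) (LEAST n. P x n)"
      using p[of x] by (intro evals_mu) (metis (full_types))+
  next
    fix x :: 'a and n
    assume "evals g (PMu p) (code x) n"
    then have "evals g p (prod_encode (code x, n)) 0"
      by (blast elim: evals_elims(9))
    from evals_deterministic[OF this p] show "P x n"
      by (simp split: if_splits)
  qed
qed

lemma computable_Least:
  assumes "computable g (\<lambda>z. P (fst z) (snd z))" "\<And>x. \<exists>n. P x n"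
  shows "computable g (\<lambda>x. LEAST n :: nat. P x n)"
proof -
  obtain p where "\<And>x n. P x n \<Longrightarrow> evals g (PMu p) (code x) (LEAST n. P x n)"
    using assms(1) by (rule computable_predicate_search) blast
  with assms(2) have "evals g (PMu p) (code x) (code (LEAST n. P x n))" for x
    by (metis code_nat_def)
  then show ?thesis by (rule computableI)
qed

text \<open>The halting domain of the search program. Surjectivity excludes halting on numbers that
  code nothing.\<close>

lemma re_set_code_image:
  assumes "computable (\<lambda>_. 0) (\<lambda>z :: 'a :: coded \<times> nat. P (fst z) (snd z))" "surj (code :: 'a \<Rightarrow> nat)"
  shows "re_set (code ` {x. \<exists>n. P x n})"
proof -
  obtain p where p: "\<And>x n. P x n \<Longrightarrow> evals (\<lambda>_. 0) (PMu p) (code x) (LEAST n. P x n)"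
      "\<And>x n. evals (\<lambda>_. 0) (PMu p) (code x) n \<Longrightarrow> P x n"
    using assms(1) by (rule computable_predicate_search) blast
  have "y \<in> code ` {x. \<exists>n. P x n} \<longleftrightarrow> (\<exists>n. evals (\<lambda>_. 0) (PMu p) y n)" for y
  proof -
    obtain x :: 'a where "y = code x" using assms(2) by (rule surjE)
    then show ?thesis using p by (simp add: inj_image_mem_iff inj_def) blast
  qed
  then show ?thesis unfolding re_set_def by blast
qed

section \<open>Enumeration of the r.e. sets\<close>

fun prog_code :: "prog \<Rightarrow> nat" where
  "prog_code PZero = prod_encode (0, 0)"
| "prog_code PSucc = prod_encode (1, 0)"
| "prog_code PFst = prod_encode (2, 0)"
| "prog_code PSnd = prod_encode (3, 0)"
| "prog_code POracle = prod_encode (4, 0)"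
| "prog_code (PPair p q) = prod_encode (5, prod_encode (prog_code p, prog_code q))"
| "prog_code (PComp p q) = prod_encode (6, prod_encode (prog_code p, prog_code q))"
| "prog_code (PRec p q) = prod_encode (7, prod_encode (prog_code p, prog_code q))"
| "prog_code (PMu p) = prod_encode (8, prog_code p)"

text \<open>
  A triple \<open>(c, x, y)\<close> claims that the program with code \<open>c\<close> outputs \<open>y\<close> on \<open>x\<close>; it is justified
  if one rule of \<^const>\<open>evals\<close> with the zero oracle derives it from the claims already listed.
\<close>

definition justified :: "(nat \<times> nat \<times> nat) list \<Rightarrow> nat \<times> nat \<times> nat \<Rightarrow> bool" where
  "justified r F = (let c = fst F; x = fst (snd F); y = snd (snd F);
      t = fst (prod_decode c); d = snd (prod_decode c); p = fst (prod_decode d); q = snd (prod_decode d);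
      u = fst (prod_decode x); n = snd (prod_decode x) in
    if t = 0 then y = 0
    else if t = 1 then y = Suc x
    else if t = 2 then y = u
    else if t = 3 then y = n
    else if t = 4 then y = 0
    else if t = 5 then (p, x, fst (prod_decode y)) \<in> set r \<and> (q, x, snd (prod_decode y)) \<in> set r
    else if t = 6 then \<exists>E\<in>set r. fst E = q \<and> fst (snd E) = x \<and> (p, snd (snd E), y) \<in> set r
    else if t = 7 then
      (if n = 0 then (p, u, y) \<in> set r
       else \<exists>E\<in>set r. fst E = c \<and> fst (snd E) = prod_encode (u, n - 1) \<and>
         (q, prod_encode (u, prod_encode (n - 1, snd (snd E))), y) \<in> set r)
    else if t = 8 then (d, prod_encode (x, y), 0) \<in> set r \<and>
      (\<forall>m<y. \<exists>E\<in>set r. fst E = d \<and> fst (snd E) = prod_encode (x, m) \<and> \<not> snd (snd E) = 0)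
    else False)"

definition triple_decode :: "nat \<Rightarrow> nat \<times> nat \<times> nat" where
  "triple_decode n = (fst (prod_decode n), prod_decode (snd (prod_decode n)))"

text \<open>Every claim is tried at infinitely many stages, because only a part of the stage number encodes it.\<close>

primrec stage :: "nat \<Rightarrow> (nat \<times> nat \<times> nat) list" where
  "stage 0 = []"
| "stage (Suc s) = (if justified (stage s) (triple_decode (fst (prod_decode s)))
     then triple_decode (fst (prod_decode s)) # stage s else stage s)"

lemma stage_mono: "s \<le> s' \<Longrightarrow> set (stage s) \<subseteq> set (stage s')"
  by (induction s' rule: dec_induct) auto

lemma justified_mono:
  assumes "justified r F" "set r \<subseteq> set r'"
  shows "justified r' F"
proof -
  note m = subsetD[OF assms(2)]
  show ?thesis
    using assms(1) unfolding justified_def Let_def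
    by (auto split: if_splits intro: m; meson m)
qed

lemma stage_closed:
  assumes "justified (stage s) F"
  shows "\<exists>s'. F \<in> set (stage s')"
proof -
  \<comment> \<open>The first component makes stage \<open>n\<close> try \<open>F\<close>; the
    second makes \<open>n\<close> at least \<open>s\<close>.\<close>
  define n where "n = prod_encode (prod_encode (fst F, prod_encode (snd F)), s)"
  have F: "triple_decode (fst (prod_decode n)) = F"
    by (simp add: n_def triple_decode_def)
  have "s \<le> n"
    by (simp add: n_def le_prod_encode_2)
  then have "justified (stage n) F"
    using assms justified_mono stage_mono by blast
  then have "F \<in> set (stage (Suc n))"
    by (simp add: F)
  then show ?thesis ..
qed

text \<open>Induction on the derivation: its premises are all listed at one sufficiently late stage,
  and \<open>stage_closed\<close> then lists the conclusion.\<close>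

lemma stage_complete:
  assumes "evals (\<lambda>_. 0) p x y"
  shows "\<exists>s. (prog_code p, x, y) \<in> set (stage s)"
  using assms
proof (induction rule: evals.induct)
  case (evals_pair p x y q z)
  then obtain s s' where "(prog_code p, x, y) \<in> set (stage s)" "(prog_code q, x, z) \<in> set (stage s')"
    by blast
  then have "justified (stage (max s s')) (prog_code (PPair p q), x, prod_encode (y, z))"
    using stage_mono[of s "max s s'"] stage_mono[of s' "max s s'"]
    by (auto simp: justified_def)
  then show ?case by (rule stage_closed)
next
  case (evals_comp q x y p z)
  then obtain s s' where "(prog_code q, x, y) \<in> set (stage s)" "(prog_code p, y, z) \<in> set (stage s')"
    by blast
  then have "justified (stage (max s s')) (prog_code (PComp p q), x, z)"
    using stage_mono[of s "max s s'"] stage_mono[of s' "max s s'"]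
    by (auto simp: justified_def intro!: bexI[of _ "(prog_code q, x, y)"])
  then show ?case by (rule stage_closed)
next
  case (evals_rec_0 p x y q)
  then obtain s where "(prog_code p, x, y) \<in> set (stage s)"
    by blast
  then have "justified (stage s) (prog_code (PRec p q), prod_encode (x, 0), y)"
    by (auto simp: justified_def)
  then show ?case by (rule stage_closed)
next
  case (evals_rec_Suc p q x n y z)
  then obtain s s' where "(prog_code (PRec p q), prod_encode (x, n), y) \<in> set (stage s)"
      "(prog_code q, prod_encode (x, prod_encode (n, y)), z) \<in> set (stage s')"
    by blast
  then have "justified (stage (max s s')) (prog_code (PRec p q), prod_encode (x, Suc n), z)"
    using stage_mono[of s "max s s'"] stage_mono[of s' "max s s'"]
    by (auto simp: justified_def Let_def intro!: bexI[of _ "(prog_code (PRec p q), prod_encode (x, n), y)"])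
  then show ?case by (rule stage_closed)
next
  case (evals_mu p x n)
  then obtain s where s: "(prog_code p, prod_encode (x, n), 0) \<in> set (stage s)"
    by blast
  from evals_mu.IH(2) have
    "\<forall>m\<in>{..<n}. \<exists>s k. (prog_code p, prod_encode (x, m), Suc k) \<in> set (stage s)"
    by blast
  then obtain s' where s': "\<And>m. m < n \<Longrightarrow> \<exists>k. (prog_code p, prod_encode (x, m), Suc k) \<in> set (stage (s' m))"
    by (metis lessThan_iff)
  \<comment> \<open>A search that halts has only finitely many premises, so one stage contains them
    all.\<close>
  define S where "S = Max (insert s (s' ` {..<n}))"
  have "s \<le> S" "\<And>m. m < n \<Longrightarrow> s' m \<le> S"
    by (auto simp: S_def intro!: Max_ge)
  then have "(prog_code p, prod_encode (x, n), 0) \<in> set (stage S)"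
      "\<And>m. m < n \<Longrightarrow> \<exists>k. (prog_code p, prod_encode (x, m), Suc k) \<in> set (stage S)"
    using s s' stage_mono by blast+
  then have "justified (stage S) (prog_code (PMu p), x, n)"
    by (force simp: justified_def Let_def)
  then show ?case by (rule stage_closed)
qed (rule stage_closed[of 0], simp add: justified_def)+

text \<open>The tag in \<open>prog_code p\<close> selects the branch of \<open>justified\<close>
  that mirrors the rule for \<open>p\<close>. Claims about numbers that code no program may be
  listed too, so \<open>r\<close> speaks of codes of programs only.\<close>

lemma justified_sound:
  assumes "justified r (prog_code p, x, y)"
    and r: "\<And>p x y. (prog_code p, x, y) \<in> set r \<Longrightarrow> evals (\<lambda>_. 0) p x y"
  shows "evals (\<lambda>_. 0) p x y"
proof (cases p)
  case PZero
  then show ?thesis using assms(1) by (auto simp: justified_def intro: evals.intros)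
next
  case PSucc
  then show ?thesis using assms(1) by (auto simp: justified_def intro: evals.intros)
next
  case PFst
  then show ?thesis using assms(1) by (auto simp: justified_def evals_fst')
next
  case PSnd
  then show ?thesis using assms(1) by (auto simp: justified_def evals_snd')
next
  case POracle
  then show ?thesis
    using assms(1) evals_oracle[of "\<lambda>_. 0" x] by (auto simp: justified_def)
next
  case (PPair q q')
  then have "evals (\<lambda>_. 0) q x (fst (prod_decode y))" "evals (\<lambda>_. 0) q' x (snd (prod_decode y))"
    using assms(1) by (auto simp: justified_def intro: r)
  from evals_pair[OF this] show ?thesis by (simp add: PPair)
next
  case (PComp q q')
  then obtain z where "(prog_code q', x, z) \<in> set r" "(prog_code q, z, y) \<in> set r"
    using assms(1) by (auto simp: justified_def)
  then show ?thesis by (auto simp: PComp intro: r evals_comp)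
next
  case (PRec q q')
  obtain u n where x: "x = prod_encode (u, n)"
    by (metis prod.collapse prod_decode_inverse)
  show ?thesis
  proof (cases n)
    case 0
    then show ?thesis
      using assms(1) PRec x by (auto simp: justified_def intro: r evals_rec_0)
  next
    case (Suc m)
    then obtain z where "(prog_code p, prod_encode (u, m), z) \<in> set r"
        "(prog_code q', prod_encode (u, prod_encode (m, z)), y) \<in> set r"
      using assms(1) PRec x by (auto simp: justified_def Let_def)
    then show ?thesis
      unfolding x Suc PRec by (blast intro: r evals_rec_Suc)
  qed
next
  case (PMu q)
  then have *: "(prog_code q, prod_encode (x, y), 0) \<in> set r"
      "\<forall>m<y. \<exists>E\<in>set r. fst E = prog_code q \<and> fst (snd E) = prod_encode (x, m) \<and> snd (snd E) \<noteq> 0"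
    using assms(1) by (simp_all add: justified_def Let_def)
  have "\<exists>k. evals (\<lambda>_. 0) q (prod_encode (x, m)) (Suc k)" if m: "m < y" for m
  proof -
    obtain E where "E \<in> set r" "fst E = prog_code q" "fst (snd E) = prod_encode (x, m)" "snd (snd E) \<noteq> 0"
      using *(2) m by blast
    then obtain k where "E = (prog_code q, prod_encode (x, m), Suc k)"
      by (metis not0_implies_Suc prod.collapse)
    then show ?thesis
      using r \<open>E \<in> set r\<close> by blast
  qed
  then have "\<forall>m<y. \<exists>k. evals (\<lambda>_. 0) q (prod_encode (x, m)) (Suc k)"
    by blast
  then show ?thesis
    unfolding PMu by (intro evals_mu r[OF *(1)])
qed

lemma stage_sound: "(prog_code p, x, y) \<in> set (stage s) \<Longrightarrow> evals (\<lambda>_. 0) p x y"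
proof (induction s arbitrary: p x y)
  case (Suc s)
  show ?case
  proof (cases "(prog_code p, x, y) \<in> set (stage s)")
    case False
    then have "justified (stage s) (prog_code p, x, y)"
      using Suc.prems by (auto split: if_splits)
    then show ?thesis by (rule justified_sound) (rule Suc.IH)
  qed (rule Suc.IH)
qed simp

lemma computable_triple_decode [computable_intros]:
  assumes "computable g n"
  shows "computable g (\<lambda>x. triple_decode (n x))"
  unfolding triple_decode_def by (intro computable_intros assms)

lemma computable_prod_encode [computable_intros]:
  assumes "computable g a" "computable g b"
  shows "computable g (\<lambda>x. prod_encode (a x, b x))"
  using computable_code[OF computable_Pair[OF assms]] by simp

lemma computable_justified [computable_intros]:
  assumes "computable g r" "computable g F"
  shows "computable g (\<lambda>x. justified (r x) (F x))"
proof -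
  have "computable g (\<lambda>z. justified (fst z) (snd z))"
    unfolding justified_def Let_def by (intro computable_intros)
  from computable_comp[OF computable_Pair[OF assms] this] show ?thesis by simp
qed

lemma computable_stage [computable_intros]:
  assumes "computable g n"
  shows "computable g (\<lambda>x. stage (n x))"
  unfolding stage_def by (intro computable_intros assms)

definition halts_by :: "nat \<Rightarrow> nat \<Rightarrow> nat \<Rightarrow> bool" where
  "halts_by e x s \<longleftrightarrow> (\<exists>F\<in>set (stage s). fst F = e \<and> fst (snd F) = x)"

lemma halts_by_mono: "halts_by e x s \<Longrightarrow> s \<le> s' \<Longrightarrow> halts_by e x s'"
  unfolding halts_by_def using stage_mono by blast

text \<open>Polymorphic, so that the same indices enumerate the binary sets to be met and the sets
  of number strings used in promises.\<close>

definition enumerated :: "nat \<Rightarrow> 'a :: coded set" where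
  "enumerated e = {x. \<exists>s. halts_by e (code x) s}"

lemma enumerated_surj:
  assumes "re_set (code ` A)"
  obtains e where "enumerated e = A"
proof -
  obtain p where p: "code ` A = {x. \<exists>y. evals (\<lambda>_. 0) p x y}"
    using assms unfolding re_set_def by blast
  have "x \<in> enumerated (prog_code p) \<longleftrightarrow> x \<in> A" for x
  proof -
    have "x \<in> enumerated (prog_code p) \<longleftrightarrow> (\<exists>s y. (prog_code p, code x, y) \<in> set (stage s))"
      by (simp add: enumerated_def halts_by_def Bex_def)
    also have "\<dots> \<longleftrightarrow> (\<exists>y. evals (\<lambda>_. 0) p (code x) y)"
      using stage_sound stage_complete by blast
    also have "\<dots> \<longleftrightarrow> code x \<in> code ` A"
      by (simp add: p)
    also have "\<dots> \<longleftrightarrow> x \<in> A"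
      by (simp add: inj_image_mem_iff inj_def)
    finally show ?thesis .
  qed
  then show ?thesis by (intro that) blast
qed

lemma computable_halts_by [computable_intros]:
  assumes "computable g e" "computable g x" "computable g s"
  shows "computable g (\<lambda>u. halts_by (e u) (x u) (s u))"
proof -
  have "computable g (\<lambda>z. halts_by (fst z) (fst (snd z)) (snd (snd z)))"
    unfolding halts_by_def by (intro computable_intros)
  from computable_comp[OF computable_Pair[OF assms(1) computable_Pair[OF assms(2,3)]] this]
  show ?thesis by simp
qed

section \<open>The functional\<close>

text \<open>\<^term>\<open>None\<close> marks a requirement that has been met; it can no longer be revoked.\<close>

type_synonym entry = "(nat \<times> nat) option"

text \<open>The decidable approximation, at stage \<open>s\<close>, to \<open>in_tree e t\<close>
  for every live promise \<open>e\<close> on the stack.\<close>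

definition admissible :: "nat list \<Rightarrow> entry list \<Rightarrow> nat \<Rightarrow> bool" where
  "admissible t E s \<longleftrightarrow> (\<forall>r\<in>set E. case r of None \<Rightarrow> True
     | Some u \<Rightarrow> \<exists>F\<in>set (stage s). fst F = snd u \<and> prefix t (list_decode (fst (snd F))))"

text \<open>
  Every instruction number carries a stage bound \<open>v\<close>, except for a push. Hence \<open>out\<close> is total
  computable although the promises are only semidecidable: an instruction which cannot be verified
  by stage \<open>v\<close> is ignored.
\<close>

definition execute :: "nat \<Rightarrow> bool list \<Rightarrow> nat list \<times> entry list \<Rightarrow> nat list \<times> entry list" where
  "execute a \<sigma> S = (let k = fst (prod_decode a); u = fst (prod_decode (snd (prod_decode a)));
      v = snd (prod_decode (snd (prod_decode a))) in
    if k = 0 then (fst S, Some (u, v) # snd S)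
    else if k = 1 then
      (if prefix (fst S) (list_decode u) \<and> admissible (list_decode u) (snd S) v
       then (list_decode u, snd S) else S)
    else (case drop (fst (prod_decode u)) (snd S) of [] \<Rightarrow> S
      | r # E \<Rightarrow> (case r of None \<Rightarrow> S
        | Some w \<Rightarrow> if halts_by (fst w) (code (take (snd (prod_decode u)) \<sigma>)) v
            then (fst S, None # E) else S)))"

text \<open>The block \<open>1\<^sup>a0\<close> is the instruction with number \<open>a\<close>; the state also records the string read so far.\<close>

definition step :: "bool \<Rightarrow> bool list \<times> nat \<times> nat list \<times> entry list \<Rightarrow>
    bool list \<times> nat \<times> nat list \<times> entry list" where
  "step b S = (fst S @ [b], if b then (Suc (fst (snd S)), snd (snd S))
     else (0, execute (fst (snd S)) (fst S) (snd (snd S))))"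

definition run :: "bool list \<Rightarrow> bool list \<times> nat \<times> nat list \<times> entry list" where
  "run \<sigma> = fold step \<sigma> ([], 0, [], [])"

definition counter :: "bool list \<Rightarrow> nat" where
  "counter \<sigma> = fst (snd (run \<sigma>))"

definition out :: "bool list \<Rightarrow> nat list" where
  "out \<sigma> = fst (snd (snd (run \<sigma>)))"

definition stack :: "bool list \<Rightarrow> entry list" where
  "stack \<sigma> = snd (snd (snd (run \<sigma>)))"

text \<open>All tests in an instruction are bounded by a stage, so \<open>out\<close> is a fold of a
  computable step.\<close>

lemma computable_out [computable_intros]:
  assumes "computable g a"
  shows "computable g (\<lambda>x. out (a x))"
  unfolding out_def run_def step_def execute_def admissible_def Let_def
  by (intro computable_intros assms)

lemma fst_run [simp]: "fst (run \<sigma>) = \<sigma>"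
  by (induction \<sigma> rule: rev_induct) (simp_all add: run_def step_def)

lemma run_snoc: "run (\<sigma> @ [b]) = step b (run \<sigma>)"
  by (simp add: run_def)

lemma run_Nil [simp]: "counter [] = 0" "out [] = []" "stack [] = []"
  by (simp_all add: run_def counter_def out_def stack_def)

lemma counter_snoc [simp]: "counter (\<sigma> @ [b]) = (if b then Suc (counter \<sigma>) else 0)"
  by (simp add: counter_def run_snoc step_def)

lemma run_snoc_True [simp]: "out (\<sigma> @ [True]) = out \<sigma>" "stack (\<sigma> @ [True]) = stack \<sigma>"
  by (simp_all add: out_def stack_def run_snoc step_def)

lemma run_snoc_False:
  "(out (\<sigma> @ [False]), stack (\<sigma> @ [False])) = execute (counter \<sigma>) \<sigma> (out \<sigma>, stack \<sigma>)"
  by (simp add: counter_def out_def stack_def run_snoc step_def)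

text \<open>Ones raise the counter to \<open>a\<close> without touching output or stack, and the
  final zero executes. This needs a counter that has not yet passed \<open>a\<close>.\<close>

lemma execute_instruction:
  assumes "counter \<sigma> \<le> a"
  obtains \<sigma>' where "prefix \<sigma> \<sigma>'" "counter (\<sigma>' @ [False]) = 0"
    "(out (\<sigma>' @ [False]), stack (\<sigma>' @ [False])) = execute a \<sigma>' (out \<sigma>, stack \<sigma>)"
proof -
  have *: "counter (\<sigma> @ replicate n True) = counter \<sigma> + n \<and>
      out (\<sigma> @ replicate n True) = out \<sigma> \<and> stack (\<sigma> @ replicate n True) = stack \<sigma>" for n
  proof (induction n)
    case (Suc n)
    have "\<sigma> @ replicate (Suc n) True = (\<sigma> @ replicate n True) @ [True]"
      by (simp add: replicate_append_same)
    then show ?case using Suc by (simp only: counter_snoc run_snoc_True) simp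
  qed simp
  show ?thesis
    using assms *[of "a - counter \<sigma>"] run_snoc_False[of "\<sigma> @ replicate (a - counter \<sigma>) True"]
    by (intro that[of "\<sigma> @ replicate (a - counter \<sigma>) True"]) (simp_all del: append_assoc)
qed

text \<open>The later invariants of output and stack rest on these four effects. The head of the
  stack is its newest entry, so \<open>met\<close> removes everything pushed after the entry at
  depth \<open>d\<close>.\<close>

lemma run_snoc_cases:
  obtains (stay) "out (\<sigma> @ [b]) = out \<sigma>" "stack (\<sigma> @ [b]) = stack \<sigma>"
  | (push) i e where "out (\<sigma> @ [b]) = out \<sigma>" "stack (\<sigma> @ [b]) = Some (i, e) # stack \<sigma>"
  | (extend) s where "prefix (out \<sigma>) (out (\<sigma> @ [b]))" "admissible (out (\<sigma> @ [b])) (stack \<sigma>) s"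
      "stack (\<sigma> @ [b]) = stack \<sigma>"
  | (met) d k s i e E where "drop d (stack \<sigma>) = Some (i, e) # E" "halts_by i (code (take k \<sigma>)) s"
      "counter (\<sigma> @ [b]) = 0" "out (\<sigma> @ [b]) = out \<sigma>" "stack (\<sigma> @ [b]) = None # E"
proof (cases b)
  case True
  then show ?thesis using stay by simp
next
  case False
  then show ?thesis
    using run_snoc_False[of \<sigma>] stay push extend met
    by (cases "prod_decode (snd (prod_decode (counter \<sigma>)))")
      (auto simp: execute_def Let_def split: if_splits list.splits option.splits)
qed

section \<open>Monotonicity and the survival of promises\<close>

lemma out_mono: "prefix \<sigma> \<tau> \<Longrightarrow> prefix (out \<sigma>) (out \<tau>)"
proof (induction \<tau> rule: rev_induct)
  case (snoc b \<tau>)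
  have "prefix (out \<tau>) (out (\<tau> @ [b]))"
    by (cases rule: run_snoc_cases[of \<tau> b]) auto
  with snoc show ?case by auto
qed simp

text \<open>Closing upwards matters because a set may be entered in the middle of a block, while
  revocation comes only at the end of one.\<close>

definition meets :: "nat \<Rightarrow> bool list \<Rightarrow> bool" where
  "meets i \<sigma> \<longleftrightarrow> (\<exists>\<pi>. prefix \<pi> \<sigma> \<and> \<pi> \<in> enumerated i)"

lemma meets_mono: "meets i \<sigma> \<Longrightarrow> prefix \<sigma> \<tau> \<Longrightarrow> meets i \<tau>"
  unfolding meets_def by (blast intro: prefix_order.trans)

lemma meets_take: "halts_by i (code (take k \<sigma>)) s \<Longrightarrow> meets i \<sigma>"
  unfolding meets_def enumerated_def by (blast intro: take_is_prefix)

text \<open>The tree of initial segments of members of the \<open>e\<close>-th r.e. set, to which a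
  promise confines the output.\<close>

definition in_tree :: "nat \<Rightarrow> nat list \<Rightarrow> bool" where
  "in_tree e t \<longleftrightarrow> (\<exists>\<nu>\<in>enumerated e. prefix t \<nu>)"

lemma code_nat_list: "code (xs :: nat list) = list_encode xs"
  by (simp add: code_list)

lemma admissible_in_tree:
  assumes "admissible t E s" "Some (i, e) \<in> set E"
  shows "in_tree e t"
proof -
  obtain F where F: "F \<in> set (stage s)" "fst F = e" "prefix t (list_decode (fst (snd F)))"
    using assms unfolding admissible_def by force
  then have "list_decode (fst (snd F)) \<in> enumerated e"
    unfolding enumerated_def halts_by_def code_nat_list by auto
  with F(3) show ?thesis unfolding in_tree_def by blast
qed

lemma admissible_mono:
  assumes "admissible t E s" "s \<le> s'"
  shows "admissible t E s'"
  using assms(1) stage_mono[OF assms(2)] unfolding admissible_def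
  by (force split: option.splits)

text \<open>Each of the finitely many promises is verified at some stage; the maximum of these
  stages serves for all.\<close>

lemma in_tree_admissible:
  assumes "\<And>i e. Some (i, e) \<in> set E \<Longrightarrow> in_tree e t"
  obtains s where "admissible t E s"
proof -
  have "\<exists>s. admissible t E s"
    using assms
  proof (induction E)
    case Nil
    then show ?case by (simp add: admissible_def)
  next
    case (Cons r E)
    then obtain s where s: "admissible t E s" by auto
    show ?case
    proof (cases r)
      case None
      then show ?thesis using s by (auto simp: admissible_def)
    next
      case (Some u)
      then obtain \<nu> s' where \<nu>: "prefix t \<nu>" "halts_by (snd u) (list_encode \<nu>) s'"
        using Cons.prems[of "fst u" "snd u"] by (auto simp: in_tree_def enumerated_def code_nat_list)
      have "halts_by (snd u) (list_encode \<nu>) (max s s')" "admissible t E (max s s')"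
        using \<nu>(2) s by (auto intro: halts_by_mono admissible_mono)
      then have "admissible t (r # E) (max s s')"
        using \<nu>(1) Some by (force simp: admissible_def halts_by_def)
      then show ?thesis ..
    qed
  qed
  then show ?thesis using that by blast
qed

text \<open>A revocation reaching into \<open>E\<close> would hit an entry whose requirement is met,
  contrary to assumption. An extension is checked against the whole stack, hence against
  \<open>E\<close>.\<close>

lemma stack_snoc:
  assumes "stack \<sigma> = U @ E" "\<And>i e. Some (i, e) \<in> set E \<Longrightarrow> \<not> meets i \<sigma>"
    and "\<And>i e. Some (i, e) \<in> set E \<Longrightarrow> in_tree e (out \<sigma>)"
  shows "(\<exists>U. stack (\<sigma> @ [b]) = U @ E) \<and> (\<forall>i e. Some (i, e) \<in> set E \<longrightarrow> in_tree e (out (\<sigma> @ [b])))"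
proof (cases rule: run_snoc_cases[of \<sigma> b])
  case stay
  then show ?thesis using assms by auto
next
  case (push i e)
  then show ?thesis using assms by auto
next
  case (extend s)
  then show ?thesis using assms(1) by (auto intro: admissible_in_tree)
next
  case (met d k s i e R)
  have "d < length U"
  proof (rule ccontr)
    assume "\<not> d < length U"
    then have "Some (i, e) \<in> set (drop (d - length U) E)"
      using met(1) assms(1) by simp
    then show False
      using assms(2) met(2) meets_take by (meson in_set_dropD)
  qed
  then have "R = drop (Suc d) U @ E"
    using met(1) assms(1) by (auto simp: Cons_nth_drop_Suc[symmetric])
  then show ?thesis using met assms by auto
qed

lemma prefix_snoc_induct [consumes 1, case_names base snoc]:
  assumes "prefix \<rho> \<sigma>" "P \<rho>" "\<And>\<sigma> b. prefix \<rho> \<sigma> \<Longrightarrow> P \<sigma> \<Longrightarrow> P (\<sigma> @ [b])"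
  shows "P \<sigma>"
  using assms(1)
proof (induction \<sigma> rule: rev_induct)
  case (snoc b \<sigma>)
  then show ?case using assms(2,3) by auto
qed (use assms(2) in simp)

text \<open>Both halves go through one induction: kept promises keep the requirements unmet, so the
  entries survive, so the next output is again checked against them.\<close>

lemma stack_persists:
  assumes "prefix \<rho> \<sigma>"
    and "\<And>i e \<tau>. Some (i, e) \<in> set (stack \<rho>) \<Longrightarrow> prefix \<rho> \<tau> \<Longrightarrow>
      \<forall>i e. Some (i, e) \<in> set (stack \<rho>) \<longrightarrow> in_tree e (out \<tau>) \<Longrightarrow> \<not> meets i \<tau>"
    and "\<And>i e. Some (i, e) \<in> set (stack \<rho>) \<Longrightarrow> in_tree e (out \<rho>)"
  shows "(\<exists>U. stack \<sigma> = U @ stack \<rho>) \<and> (\<forall>i e. Some (i, e) \<in> set (stack \<rho>) \<longrightarrow> in_tree e (out \<sigma>))"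
  using assms(1)
proof (induction rule: prefix_snoc_induct)
  case base
  then show ?case using assms(3) by auto
next
  case (snoc \<sigma> b)
  then obtain U where "stack \<sigma> = U @ stack \<rho>" by blast
  then show ?case
    by (rule stack_snoc) (use snoc assms(2) in blast)+
qed

section \<open>Deciding the requirements\<close>

lemma take_seg: "take k (seg f n) = seg f (min k n)"
  by (simp add: seg_def take_map min_def)

lemma initial_segment_prefix:
  assumes "prefix s t" "initial_segment t f"
  shows "initial_segment s f"
proof -
  obtain n where "t = seg f n" using assms(2) by (auto simp: initial_segment_def)
  then have "s = take (length s) (seg f n)" using assms(1) by (auto simp: prefix_def)
  then show ?thesis unfolding initial_segment_def take_seg by blast
qed

lemma prefix_seg: "n \<le> m \<Longrightarrow> prefix (seg f n) (seg f m)"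
  using take_is_prefix[of n "seg f m"] by (simp add: take_seg min_def)

lemma length_seg [simp]: "length (seg f n) = n"
  by (simp add: seg_def)

lemma initial_segment_seg [simp]: "initial_segment (seg f n) f"
  by (auto simp: initial_segment_def)

lemma dense_in_tree: "dense_in (enumerated e) f \<Longrightarrow> initial_segment t f \<Longrightarrow> in_tree e t"
  unfolding dense_in_def in_tree_def initial_segment_def by blast

text \<open>Counter 0 means that no block is half read, so any instruction may follow. Density
  ensures that the promises never block an output along \<open>f\<close>.\<close>

definition good :: "(nat \<Rightarrow> nat) \<Rightarrow> bool list \<Rightarrow> bool" where
  "good f \<rho> \<longleftrightarrow> counter \<rho> = 0 \<and> initial_segment (out \<rho>) f \<and>
     (\<forall>i e. Some (i, e) \<in> set (stack \<rho>) \<longrightarrow> dense_in (enumerated e) f)"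

definition settled :: "nat \<Rightarrow> bool list \<Rightarrow> bool" where
  "settled i \<rho> \<longleftrightarrow> (\<forall>\<sigma>. prefix \<rho> \<sigma> \<longrightarrow> \<not> meets i \<sigma>)"

lemma settled_mono: "settled i \<rho> \<Longrightarrow> prefix \<rho> \<sigma> \<Longrightarrow> settled i \<sigma>"
  unfolding settled_def by (blast intro: prefix_order.trans)

text \<open>No live entry can be revoked above \<rho>, whatever the output there, since revocation
  requires a met requirement.\<close>

definition secure :: "bool list \<Rightarrow> bool" where
  "secure \<rho> \<longleftrightarrow> (\<forall>i e. Some (i, e) \<in> set (stack \<rho>) \<longrightarrow> settled i \<rho>)"

text \<open>By density \<open>seg f n\<close> lies in the trees of all promises, so the instruction
  to extend to it succeeds with a late enough stage bound.\<close>

lemma good_extend: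
  assumes "good f \<rho>" "length (out \<rho>) \<le> n"
  obtains \<rho>' where "prefix \<rho> \<rho>'" "good f \<rho>'" "out \<rho>' = seg f n" "stack \<rho>' = stack \<rho>"
proof -
  have \<rho>: "counter \<rho> = 0" "initial_segment (out \<rho>) f"
      "\<And>i e. Some (i, e) \<in> set (stack \<rho>) \<Longrightarrow> dense_in (enumerated e) f"
    using assms(1) by (auto simp: good_def)
  have "out \<rho> = seg f (length (out \<rho>))"
    using \<rho>(2) by (auto simp: initial_segment_def)
  then have pre: "prefix (out \<rho>) (seg f n)"
    using prefix_seg[OF assms(2)] by metis
  obtain s where s: "admissible (seg f n) (stack \<rho>) s"
    by (rule in_tree_admissible[of "stack \<rho>" "seg f n"]) (auto intro: dense_in_tree \<rho>(3))
  obtain \<sigma> where "prefix \<rho> \<sigma>" "counter (\<sigma> @ [False]) = 0"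
      "(out (\<sigma> @ [False]), stack (\<sigma> @ [False])) =
        execute (prod_encode (1, prod_encode (list_encode (seg f n), s))) \<sigma> (out \<rho>, stack \<rho>)"
    by (rule execute_instruction[of \<rho> "prod_encode (1, prod_encode (list_encode (seg f n), s))"])
      (auto simp: \<rho>(1))
  then show ?thesis
    using pre s \<rho>(3) by (intro that[of "\<sigma> @ [False]"]) (auto simp: execute_def good_def)
qed

lemma good_push:
  assumes "good f \<rho>" "dense_in (enumerated e) f"
  obtains \<rho>' where "prefix \<rho> \<rho>'" "good f \<rho>'" "out \<rho>' = out \<rho>" "stack \<rho>' = Some (i, e) # stack \<rho>"
proof -
  have \<rho>: "counter \<rho> = 0" "initial_segment (out \<rho>) f"
      "\<And>i e. Some (i, e) \<in> set (stack \<rho>) \<Longrightarrow> dense_in (enumerated e) f"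
    using assms(1) by (auto simp: good_def)
  obtain \<sigma> where "prefix \<rho> \<sigma>" "counter (\<sigma> @ [False]) = 0"
      "(out (\<sigma> @ [False]), stack (\<sigma> @ [False])) =
        execute (prod_encode (0, prod_encode (i, e))) \<sigma> (out \<rho>, stack \<rho>)"
    by (rule execute_instruction[of \<rho> "prod_encode (0, prod_encode (i, e))"]) (auto simp: \<rho>(1))
  then show ?thesis
    using \<rho> assms(2) by (intro that[of "\<sigma> @ [False]"]) (auto simp: execute_def good_def)
qed

lemma good_in_tree: "good f \<rho> \<Longrightarrow> Some (i, e) \<in> set (stack \<rho>) \<Longrightarrow> in_tree e (out \<rho>)"
  unfolding good_def by (blast intro: dense_in_tree)

text \<open>Security protects the entries below the pushed one. So that entry is either still
  present or was itself revoked, and \<eta> is the string right after that revocation.\<close>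

lemma pushed_stack_cases:
  assumes "good f \<rho>" "secure \<rho>" "prefix \<rho> \<rho>'" "stack \<rho>' = Some (i, e) # stack \<rho>" "prefix \<rho>' \<sigma>"
  shows "(\<exists>U. stack \<sigma> = U @ Some (i, e) # stack \<rho>) \<or>
    (\<exists>\<eta>. prefix \<rho>' \<eta> \<and> prefix \<eta> \<sigma> \<and> counter \<eta> = 0 \<and> stack \<eta> = None # stack \<rho> \<and> meets i \<eta>)"
  using assms(5)
proof (induction rule: prefix_snoc_induct)
  case base
  then show ?case using assms(4) by auto
next
  case (snoc \<sigma> b)
  from snoc.IH show ?case
  proof
    assume "\<exists>U. stack \<sigma> = U @ Some (i, e) # stack \<rho>"
    then obtain U where U: "stack \<sigma> = U @ Some (i, e) # stack \<rho>" ..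
    show ?thesis
    proof (cases rule: run_snoc_cases[of \<sigma> b])
      case stay
      then show ?thesis using U by auto
    next
      case (push i e)
      then show ?thesis using U by auto
    next
      case (extend s)
      then show ?thesis using U by auto
    next
      case (met d k s j e' E)
      consider "d < length U" | "d = length U" | "d > length U" by linarith
      then show ?thesis
      proof cases
        case 1
        then have "E = drop (Suc d) U @ Some (i, e) # stack \<rho>"
          using met(1) U by (auto simp: Cons_nth_drop_Suc[symmetric])
        then show ?thesis using met(5) by simp
      next
        case 2
        then have "j = i" "E = stack \<rho>" using met(1) U by auto
        then have "stack (\<sigma> @ [b]) = None # stack \<rho>" "meets i (\<sigma> @ [b])"
          using met(5) meets_mono[OF meets_take[OF met(2)], of "\<sigma> @ [b]"] by simp_all
        then show ?thesis using snoc.hyps met(3) by (intro disjI2 exI[of _ "\<sigma> @ [b]"]) simp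
      next
        case 3
        then have "Some (j, e') \<in> set (drop (d - length U - 1) (stack \<rho>))"
          using met(1) U by (cases "d - length U") auto
        then have "\<not> meets j \<sigma>"
          using assms(2,3) snoc.hyps unfolding secure_def settled_def
          by (meson in_set_dropD prefix_order.trans)
        then show ?thesis using met(2) meets_take by blast
      qed
    qed
  next
    assume "\<exists>\<eta>. prefix \<rho>' \<eta> \<and> prefix \<eta> \<sigma> \<and> counter \<eta> = 0 \<and> stack \<eta> = None # stack \<rho> \<and> meets i \<eta>"
    then obtain \<eta> where "prefix \<rho>' \<eta>" "prefix \<eta> \<sigma>" "counter \<eta> = 0" "stack \<eta> = None # stack \<rho>" "meets i \<eta>"
      by blast
    then show ?thesis by (intro disjI2 exI[of _ \<eta>]) simp
  qed
qed

text \<open>Promises in \<sigma> not dense in \<open>f\<close> can only lie above the pushed entry,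
  so they vanish when it is replaced by \<open>None\<close>. This entry imposes nothing in
  \<open>good\<close> or \<open>secure\<close>.\<close>

lemma meet_requirement:
  assumes "good f \<rho>" "secure \<rho>" "prefix \<rho> \<rho>'" "stack \<rho>' = Some (i, e) # stack \<rho>" "prefix \<rho>' \<sigma>"
    and "meets i \<sigma>" "initial_segment (out \<sigma>) f"
  obtains \<eta> where "prefix \<rho> \<eta>" "good f \<eta>" "secure \<eta>" "meets i \<eta>"
proof -
  have "\<exists>\<eta>. prefix \<rho>' \<eta> \<and> counter \<eta> = 0 \<and> stack \<eta> = None # stack \<rho> \<and> meets i \<eta> \<and> initial_segment (out \<eta>) f"
    using pushed_stack_cases[OF assms(1-5)]
  proof
    assume "\<exists>U. stack \<sigma> = U @ Some (i, e) # stack \<rho>"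
    then obtain U where U: "stack \<sigma> = U @ Some (i, e) # stack \<rho>" ..
    obtain \<pi> s where \<pi>: "prefix \<pi> \<sigma>" "halts_by i (code \<pi>) s"
      using assms(6) by (auto simp: meets_def enumerated_def)
    \<comment> \<open>\<open>\<sigma>\<close> may end inside a block, so the instruction number must be at least the counter.\<close>
    define s' where "s' = max s (counter \<sigma>)"
    \<comment> \<open>Tag 2 revokes: \<open>length U\<close> is the depth of the pushed entry, and
      \<open>length \<pi>\<close> locates the initial segment in the r.e. set.\<close>
    define a where "a = prod_encode (2, prod_encode (prod_encode (length U, length \<pi>), s'))"
    have "s' \<le> a"
      unfolding a_def by (meson le_prod_encode_2 order_trans)
    then have "counter \<sigma> \<le> a" by (simp add: s'_def)
    then obtain \<sigma>' where \<sigma>': "prefix \<sigma> \<sigma>'" "counter (\<sigma>' @ [False]) = 0"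
        "(out (\<sigma>' @ [False]), stack (\<sigma>' @ [False])) = execute a \<sigma>' (out \<sigma>, stack \<sigma>)"
      by (rule execute_instruction)
    have "take (length \<pi>) \<sigma>' = \<pi>"
      using \<pi>(1) \<sigma>'(1) by (auto simp: prefix_def)
    then have "out (\<sigma>' @ [False]) = out \<sigma>" "stack (\<sigma>' @ [False]) = None # stack \<rho>"
      using \<sigma>'(3) U halts_by_mono[OF \<pi>(2), of s'] by (auto simp: execute_def a_def s'_def)
    moreover have "meets i (\<sigma>' @ [False])"
      using meets_mono[OF assms(6)] \<sigma>'(1) by simp
    moreover have "prefix \<rho>' (\<sigma>' @ [False])"
      using prefix_order.trans[OF assms(5) \<sigma>'(1)] by simp
    ultimately show ?thesis using \<sigma>'(2) assms(7) by metis
  next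
    \<comment> \<open>The revocation has already happened, so \<sigma> is cut back to \<eta>; by
      monotonicity the output there is still along \<open>f\<close>.\<close>
    assume "\<exists>\<eta>. prefix \<rho>' \<eta> \<and> prefix \<eta> \<sigma> \<and> counter \<eta> = 0 \<and> stack \<eta> = None # stack \<rho> \<and> meets i \<eta>"
    then show ?thesis
      using assms(7) out_mono initial_segment_prefix by blast
  qed
  then obtain \<eta> where \<eta>: "prefix \<rho> \<eta>" "counter \<eta> = 0" "stack \<eta> = None # stack \<rho>" "meets i \<eta>"
      "initial_segment (out \<eta>) f"
    using assms(3) prefix_order.trans by blast
  show ?thesis
  proof (rule that)
    show "good f \<eta>" using \<eta> assms(1) by (auto simp: good_def)
    show "secure \<eta>" using \<eta>(3) assms(2) settled_mono[OF _ \<eta>(1)] by (simp add: secure_def)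
  qed (use \<eta> in auto)
qed

section \<open>R.e. sets of strings\<close>

lemma surj_code_nat_list: "surj (code :: nat list \<Rightarrow> nat)"
  by (simp add: surj_def code_nat_list) (metis list_decode_inverse)

text \<open>A witness \<open>w\<close> codes a candidate \<sigma> and a stage bound. Reading nonzero
  entries as \<open>True\<close> turns every number list into a binary string, so the matrix is
  decidable.\<close>

lemma re_strings_outputs:
  "re_strings {out \<sigma> |\<sigma>. prefix \<rho> \<sigma> \<and> \<sigma> \<in> enumerated i}"
proof -
  let ?\<sigma> = "\<lambda>w. map (\<lambda>n :: nat. \<not> n = 0) (list_decode (fst (prod_decode w)))"
  let ?P = "\<lambda>t w. prefix \<rho> (?\<sigma> w) \<and> halts_by i (code (?\<sigma> w)) (snd (prod_decode w)) \<and> out (?\<sigma> w) = t"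
  have "{out \<sigma> |\<sigma>. prefix \<rho> \<sigma> \<and> \<sigma> \<in> enumerated i} = {t. \<exists>w. ?P t w}"
  proof (intro set_eqI iffI)
    fix t assume "t \<in> {out \<sigma> |\<sigma>. prefix \<rho> \<sigma> \<and> \<sigma> \<in> enumerated i}"
    then obtain \<sigma> s where \<sigma>: "t = out \<sigma>" "prefix \<rho> \<sigma>" "halts_by i (code \<sigma>) s"
      by (auto simp: enumerated_def)
    define w where "w = prod_encode (list_encode (map of_bool \<sigma>), s)"
    have "?\<sigma> w = \<sigma>" "snd (prod_decode w) = s"
      by (simp_all add: w_def o_def)
    then show "t \<in> {t. \<exists>w. ?P t w}"
      using \<sigma> by (intro CollectI exI[of _ w]) simp
  next
    fix t assume "t \<in> {t. \<exists>w. ?P t w}"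
    then show "t \<in> {out \<sigma> |\<sigma>. prefix \<rho> \<sigma> \<and> \<sigma> \<in> enumerated i}"
      unfolding enumerated_def by blast
  qed
  moreover have "re_set (code ` {t. \<exists>w. ?P t w})"
  proof (rule re_set_code_image)
    show "computable (\<lambda>_. 0) (\<lambda>z. ?P (fst z) (snd z))"
      by (intro computable_intros)
  qed (rule surj_code_nat_list)
  ultimately show ?thesis
    by (simp add: re_strings_def code_nat_list image_def)
qed

lemma enumerated_re_strings:
  assumes "re_strings W"
  obtains e where "enumerated e = W"
proof (rule enumerated_surj)
  show "re_set (code ` W)"
    using assms by (simp add: re_strings_def code_nat_list image_def)
qed

text \<open>Supplies the index of the vacuous promise.\<close>

lemma enumerated_UNIV:
  obtains e where "enumerated e = (UNIV :: nat list set)"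
proof (rule enumerated_surj)
  have "UNIV = {x. \<exists>y. evals (\<lambda>_. 0) PZero x y}"
    by (blast intro: evals_zero)
  then show "re_set (code ` (UNIV :: nat list set))"
    using surj_code_nat_list unfolding re_set_def by metis
qed

lemma decide_requirement:
  assumes nd: "\<not> (\<exists>Y. Sigma01_dense_in Y f)" and "good f \<rho>" "secure \<rho>"
  obtains \<rho>' where "prefix \<rho> \<rho>'" "good f \<rho>'" "secure \<rho>'" "meets i \<rho>' \<or> settled i \<rho>'"
proof -
  obtain e where e: "enumerated e = (UNIV :: nat list set)"
    by (rule enumerated_UNIV)
  then have "dense_in (enumerated e) f"
    by (auto simp: dense_in_def)
  then obtain \<rho>1 where \<rho>1: "prefix \<rho> \<rho>1" "good f \<rho>1" "stack \<rho>1 = Some (i, e) # stack \<rho>"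
    by (rule good_push[OF assms(2), where i = i]) blast
  show ?thesis
  proof (cases "\<exists>\<sigma>. prefix \<rho>1 \<sigma> \<and> meets i \<sigma> \<and> initial_segment (out \<sigma>) f")
    case True
    then show ?thesis
      using meet_requirement[OF assms(2,3) \<rho>1(1,3)] that by blast
  next
    case False
    define Y where "Y = {out \<sigma> |\<sigma>. prefix \<rho>1 \<sigma> \<and> \<sigma> \<in> enumerated i}"
    \<comment> \<open>The member \<pi> of the set below \<sigma> must extend \<rho>1, since
      otherwise \<rho>1, whose output is along \<open>f\<close>, would already meet the set.
      Monotonicity places \<open>out \<pi>\<close> below \<open>out \<sigma>\<close>.\<close>
    have Y: "\<exists>y\<in>Y. prefix y (out \<sigma>)" "\<not> meets i \<rho>1" if \<sigma>: "prefix \<rho>1 \<sigma>" "meets i \<sigma>" for \<sigma>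
    proof -
      show *: "\<not> meets i \<rho>1"
        using False \<rho>1(2) by (auto simp: good_def)
      obtain \<pi> where \<pi>: "prefix \<pi> \<sigma>" "\<pi> \<in> enumerated i"
        using \<sigma>(2) by (auto simp: meets_def)
      then have "prefix \<rho>1 \<pi>"
        using * \<sigma>(1) prefix_same_cases unfolding meets_def by blast
      then show "\<exists>y\<in>Y. prefix y (out \<sigma>)"
        using \<pi> out_mono unfolding Y_def by blast
    qed
    have notseg: "\<not> initial_segment y f" if "y \<in> Y" for y
      using that False unfolding Y_def meets_def by blast
    \<comment> \<open>The entries added since \<rho> all belong to requirement \<open>i\<close>; the
      older ones are settled already.\<close>
    have secure: "secure \<rho>2"
      if "prefix \<rho>1 \<rho>2" "settled i \<rho>2" "set (stack \<rho>2) \<subseteq> {Some (i, e') |e'. True} \<union> set (stack \<rho>)" for \<rho>2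
      unfolding secure_def
    proof (intro allI impI)
      fix j d assume "Some (j, d) \<in> set (stack \<rho>2)"
      then have "j = i \<or> Some (j, d) \<in> set (stack \<rho>)" using that(3) by auto
      then show "settled j \<rho>2"
        using that(2) assms(3) settled_mono[OF _ prefix_order.trans[OF \<rho>1(1) that(1)]]
        unfolding secure_def by blast
    qed
    show ?thesis
    proof (cases "finite Y")
      case True
      \<comment> \<open>Long enough to extend the current output and to be no shorter than any
        member of \<open>Y\<close>.\<close>
      define n where "n = Max (insert (length (out \<rho>1)) (length ` Y))"
      have n: "length (out \<rho>1) \<le> n" "\<And>y. y \<in> Y \<Longrightarrow> length y \<le> n"
        using True by (auto simp: n_def intro!: Max_ge)
      obtain \<rho>2 where \<rho>2: "prefix \<rho>1 \<rho>2" "good f \<rho>2" "out \<rho>2 = seg f n" "stack \<rho>2 = stack \<rho>1"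
        by (rule good_extend[OF \<rho>1(2) n(1)]) blast
      have "settled i \<rho>2"
        unfolding settled_def
      proof (intro allI impI notI)
        fix \<sigma> assume \<sigma>: "prefix \<rho>2 \<sigma>" "meets i \<sigma>"
        then obtain y where y: "y \<in> Y" "prefix y (out \<sigma>)"
          using Y(1)[OF prefix_order.trans[OF \<rho>2(1) \<sigma>(1)]] by blast
        have "prefix (seg f n) (out \<sigma>)"
          using out_mono[OF \<sigma>(1)] \<rho>2(3) by simp
        \<comment> \<open>Both are initial segments of \<open>out \<sigma>\<close> and
          \<open>y\<close> is not the longer one; thus \<open>y\<close> would lie along
          \<open>f\<close>.\<close>
        then have "prefix y (seg f n)"
          using y n(2) by (metis length_seg prefix_length_prefix)
        then show False
          using notseg[OF y(1)] initial_segment_prefix initial_segment_seg by blast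
      qed
      then show ?thesis
        using that[of \<rho>2] \<rho>1 \<rho>2 secure[of \<rho>2] prefix_order.trans[OF \<rho>1(1) \<rho>2(1)] by auto
    next
      case False
      have "re_strings Y"
        unfolding Y_def by (rule re_strings_outputs)
      \<comment> \<open>\<open>Y\<close> is infinite, r.e. and contains no initial segment of
        \<open>f\<close>, so only the clause on dense sets can fail, and \<open>W\<close> witnesses
        this.\<close>
      then obtain W where W: "re_strings W" "dense_in W f" "\<And>y t. y \<in> Y \<Longrightarrow> t \<in> W \<Longrightarrow> \<not> prefix y t"
        using nd False notseg unfolding Sigma01_dense_in_def by blast
      obtain e' where e': "enumerated e' = W"
        using W(1) by (rule enumerated_re_strings)
      have "dense_in (enumerated e') f" using W(2) e' by simp
      then obtain \<rho>2 where \<rho>2: "prefix \<rho>1 \<rho>2" "good f \<rho>2" "stack \<rho>2 = Some (i, e') # stack \<rho>1"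
        by (rule good_push[OF \<rho>1(2), where i = i]) blast
      \<comment> \<open>Otherwise \<open>out \<sigma>\<close> lies between a member of
        \<open>Y\<close> and a member of \<open>W\<close> extending it.\<close>
      have avoid: "\<not> meets i \<sigma>" if \<sigma>: "prefix \<rho>2 \<sigma>" "in_tree e' (out \<sigma>)" for \<sigma>
      proof
        assume "meets i \<sigma>"
        then obtain y where "y \<in> Y" "prefix y (out \<sigma>)"
          using Y(1)[OF prefix_order.trans[OF \<rho>2(1) \<sigma>(1)]] by blast
        moreover obtain t where "t \<in> W" "prefix (out \<sigma>) t"
          using \<sigma>(2) e' by (auto simp: in_tree_def)
        ultimately show False
          using W(3) prefix_order.trans by blast
      qed
      have "settled i \<rho>2"
        unfolding settled_def
      proof (intro allI impI)
        fix \<sigma> assume \<sigma>: "prefix \<rho>2 \<sigma>"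
        have "\<forall>j d. Some (j, d) \<in> set (stack \<rho>2) \<longrightarrow> in_tree d (out \<sigma>)"
        proof (rule conjunct2[OF stack_persists[OF \<sigma>]])
          \<comment> \<open>Kept promises protect both entries for \<open>i\<close> through
            \<open>avoid\<close>; the entries of \<open>stack \<rho>\<close> are protected by
            security of \<rho>.\<close>
          fix j d \<tau>
          assume j: "Some (j, d) \<in> set (stack \<rho>2)" "prefix \<rho>2 \<tau>"
            "\<forall>i e. Some (i, e) \<in> set (stack \<rho>2) \<longrightarrow> in_tree e (out \<tau>)"
          then have "\<not> meets i \<tau>" using avoid \<rho>2(3) by auto
          moreover have "\<not> meets j \<tau>" if "Some (j, d) \<in> set (stack \<rho>)"
            using that assms(3) \<rho>1(1) \<rho>2(1) j(2) unfolding secure_def settled_def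
            by (meson prefix_order.trans)
          ultimately show "\<not> meets j \<tau>"
            using j(1) \<rho>1(3) \<rho>2(3) by auto
        qed (rule good_in_tree[OF \<rho>2(2)])
        then show "\<not> meets i \<sigma>" using avoid[OF \<sigma>] \<rho>2(3) by auto
      qed
      then show ?thesis
        using that[of \<rho>2] \<rho>1 \<rho>2 secure[of \<rho>2] prefix_order.trans[OF \<rho>1(1) \<rho>2(1)] by auto
    qed
  qed
qed

text \<open>After the decision the output grows by one more value of \<open>f\<close>, so that the
  outputs along \<open>G\<close> are unbounded.\<close>

lemma good_secure_step:
  assumes "\<not> (\<exists>Y. Sigma01_dense_in Y f)" "good f \<rho>" "secure \<rho>"
  shows "\<exists>\<rho>'. (good f \<rho>' \<and> secure \<rho>') \<and> prefix \<rho> \<rho>' \<and> length (out \<rho>) < length (out \<rho>') \<and>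
    (meets i \<rho>' \<or> settled i \<rho>')"
proof -
  obtain \<rho>1 where \<rho>1: "prefix \<rho> \<rho>1" "good f \<rho>1" "secure \<rho>1" "meets i \<rho>1 \<or> settled i \<rho>1"
    by (rule decide_requirement[OF assms]) blast
  obtain \<rho>2 where \<rho>2: "prefix \<rho>1 \<rho>2" "good f \<rho>2" "out \<rho>2 = seg f (Suc (length (out \<rho>1)))"
      "stack \<rho>2 = stack \<rho>1"
    using good_extend[OF \<rho>1(2), of "Suc (length (out \<rho>1))"] by auto
  have "length (out \<rho>) \<le> length (out \<rho>1)"
    using \<rho>1(1) by (intro prefix_length_le out_mono)
  moreover have "secure \<rho>2"
    using \<rho>1(3) \<rho>2(1,4) settled_mono unfolding secure_def by metis
  ultimately show ?thesis
    using \<rho>1 \<rho>2 meets_mono[OF _ \<rho>2(1)] settled_mono[OF _ \<rho>2(1)] prefix_order.trans[OF \<rho>1(1) \<rho>2(1)]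
    by (intro exI[of _ \<rho>2]) auto
qed

section \<open>The limit \<open>G\<close> and the reduction of \<open>f\<close> to it\<close>

lemma re_binary_strings_enumerated:
  assumes "re_binary_strings S"
  obtains e where "enumerated e = S"
proof (rule enumerated_surj)
  have "map (code :: bool \<Rightarrow> nat) = map of_bool"
    by (simp add: fun_eq_iff)
  then have "code ` S = list_encode ` map of_bool ` S"
    by (simp add: image_image code_list)
  then show "re_set (code ` S)"
    using assms by (simp add: re_binary_strings_def re_strings_def)
qed

lemma limit_of_prefixes:
  fixes \<rho> :: "nat \<Rightarrow> 'a list"
  assumes "\<And>n. prefix (\<rho> n) (\<rho> (Suc n))" "\<And>n. n \<le> length (\<rho> n)"
  obtains G where "\<And>n. initial_segment (\<rho> n) G"
proof -
  \<comment> \<open>\<open>\<rho> (Suc j)\<close> has length at least \<open>Suc j\<close>, so its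
    entry at \<open>j\<close> exists.\<close>
  define G where "G j = \<rho> (Suc j) ! j" for j
  have chain: "prefix (\<rho> m) (\<rho> n)" if "m \<le> n" for m n
    using that
  proof (induction n rule: dec_induct)
    case (step n)
    show ?case by (rule prefix_order.trans[OF step.IH assms(1)])
  qed simp
  have nth: "ys ! j = xs ! j" if "prefix xs ys" "j < length xs" for xs ys :: "'a list" and j
    using that by (auto simp: prefix_def nth_append)
  have "\<rho> n ! j = G j" if j: "j < length (\<rho> n)" for n j
  proof -
    have "j < length (\<rho> (Suc j))" using assms(2)[of "Suc j"] by simp
    then show ?thesis
      using nth[OF chain[of n "Suc j"] j] nth[OF chain[of "Suc j" n], of j]
      unfolding G_def by (cases "n \<le> Suc j") simp_all
  qed
  then have "\<rho> n = seg G (length (\<rho> n))" for n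
    by (intro nth_equalityI) (simp_all add: seg_def)
  then have "\<And>n. initial_segment (\<rho> n) G"
    unfolding initial_segment_def by blast
  then show ?thesis by (rule that)
qed

lemma computable_seg:
  assumes "computable g G" "computable g n"
  shows "computable g (\<lambda>x. seg G (n x))"
proof -
  have "computable g (\<lambda>z. G (snd z))"
    by (rule computable_comp[OF _ assms(1)]) (intro computable_intros)
  then show ?thesis
    unfolding seg_def by (intro computable_intros assms(2))
qed

text \<open>To find \<open>f x\<close>, search for an initial segment of \<open>G\<close> whose
  output is longer than \<open>x\<close>, and read entry \<open>x\<close> there.\<close>

lemma turing_reducible_by_outputs:
  assumes seg: "\<And>n. initial_segment (out (seg G n)) f" and unb: "\<And>x. \<exists>n. x < length (out (seg G n))"
  shows "f \<le>\<^sub>T (\<lambda>n. of_bool (G n))"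
proof -
  let ?g = "\<lambda>n. of_bool (G n) :: nat"
  let ?h = "\<lambda>x. LEAST n. x < length (out (seg G n))"
  have "computable ?g G"
    by (rule computable_oracle) simp
  note [computable_intros] = computable_seg[OF this]
  have "computable ?g ?h"
    by (rule computable_Least) (intro computable_intros, rule unb)
  note [computable_intros] = computable_comp[OF _ this]
  \<comment> \<open>The default 0 never arises, since the output found is longer than
    \<open>x\<close>.\<close>
  have "computable ?g (\<lambda>x. case drop x (out (seg G (?h x))) of [] \<Rightarrow> 0 | y # _ \<Rightarrow> y)"
    by (intro computable_intros)
  moreover have "(case drop x (out (seg G (?h x))) of [] \<Rightarrow> 0 | y # _ \<Rightarrow> y) = f x" for x
  proof -
    have "x < length (out (seg G (?h x)))"
      using unb by (rule LeastI_ex)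
    moreover obtain n where "out (seg G (?h x)) = seg f n"
      using seg by (auto simp: initial_segment_def)
    ultimately have "x < n" "out (seg G (?h x)) = seg f n" by simp_all
    moreover from \<open>x < n\<close> have "drop x (seg f n) = f x # drop (Suc x) (seg f n)"
      by (simp add: Cons_nth_drop_Suc[symmetric, of x "seg f n"]) (simp add: seg_def)
    ultimately show ?thesis by simp
  qed
  ultimately have "computable ?g f" by simp
  then show ?thesis
    by (auto simp: computable_def turing_reducible_def)
qed

theorem theorem4:
  fixes f :: "nat \<Rightarrow> nat"
  assumes "\<not> (\<exists>Y. Sigma01_dense_in Y f)"
  shows "\<exists>G :: nat \<Rightarrow> bool. one_generic G \<and> f \<le>\<^sub>T (\<lambda>n. of_bool (G n))"
proof -
  \<comment> \<open>Requirement \<open>n\<close> is decided between \<open>\<rho> n\<close> and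
    \<open>\<rho> (Suc n)\<close>.\<close>
  have "\<exists>\<rho>. \<forall>n. (good f (\<rho> n) \<and> secure (\<rho> n)) \<and> (prefix (\<rho> n) (\<rho> (Suc n)) \<and>
      length (out (\<rho> n)) < length (out (\<rho> (Suc n))) \<and> (meets n (\<rho> (Suc n)) \<or> settled n (\<rho> (Suc n))))"
  proof (rule dependent_nat_choice)
    have "good f []" "secure []"
      by (auto simp: good_def secure_def initial_segment_def seg_def)
    then show "\<exists>\<rho>. good f \<rho> \<and> secure \<rho>" by blast
  qed (use good_secure_step[OF assms] in blast)
  then obtain \<rho> where good: "\<And>n. good f (\<rho> n)"
    and pre: "\<And>n. prefix (\<rho> n) (\<rho> (Suc n))"
    and len: "\<And>n. length (out (\<rho> n)) < length (out (\<rho> (Suc n)))"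
    and dec: "\<And>n. meets n (\<rho> (Suc n)) \<or> settled n (\<rho> (Suc n))"
    by metis
  have len_out: "n \<le> length (out (\<rho> n))" for n
  proof (induction n)
    case (Suc n)
    then show ?case using len[of n] by linarith
  qed simp
  \<comment> \<open>Equal strings would have equal outputs, so a longer output forces a longer
    string and the limit is an infinite sequence.\<close>
  have len': "length (\<rho> n) < length (\<rho> (Suc n))" for n
    using pre[of n] len[of n] by (metis less_irrefl prefix_length_less strict_prefixI)
  have len_\<rho>: "n \<le> length (\<rho> n)" for n
  proof (induction n)
    case (Suc n)
    then show ?case using len'[of n] by linarith
  qed simp
  obtain G where G: "\<And>n. initial_segment (\<rho> n) G"
    using limit_of_prefixes[OF pre len_\<rho>] by blast
  then have seg: "\<rho> n = seg G (length (\<rho> n))" for n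
    by (metis initial_segment_def length_seg)
  have "one_generic G"
    unfolding one_generic_def
  proof (intro allI impI)
    fix S assume "re_binary_strings S"
    then obtain e where e: "enumerated e = S"
      by (rule re_binary_strings_enumerated)
    from dec[of e] show "(\<exists>\<sigma>\<in>S. initial_segment \<sigma> G) \<or>
        (\<exists>\<rho>. initial_segment \<rho> G \<and> \<not> (\<exists>\<tau>\<in>S. prefix \<rho> \<tau>))"
    proof
      assume "meets e (\<rho> (Suc e))"
      then show ?thesis
        using G initial_segment_prefix e unfolding meets_def by blast
    next
      assume "settled e (\<rho> (Suc e))"
      then show ?thesis
        using G e unfolding settled_def meets_def by blast
    qed
  qed
  moreover have "f \<le>\<^sub>T (\<lambda>n. of_bool (G n))"
  proof (rule turing_reducible_by_outputs)
    fix n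
    have "prefix (seg G n) (\<rho> n)"
      using prefix_seg[OF len_\<rho>, where n = n and f = G] by (simp only: seg[symmetric])
    then show "initial_segment (out (seg G n)) f"
      using good out_mono initial_segment_prefix unfolding good_def by blast
  next
    fix x
    have "x < length (out (\<rho> (Suc x)))" using len_out[of "Suc x"] by simp
    then have "x < length (out (seg G (length (\<rho> (Suc x)))))"
      by (simp only: seg[symmetric])
    then show "\<exists>n. x < length (out (seg G n))" ..
  qed
  ultimately show ?thesis by blast
qed

end
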